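(* For every integer $N\ge 1$ the classical Hecke correspondence $T_N$ acts on $\mathbb{Z}\lambda(\mathrm{SL}_2(\mathbb{Z}))$, i.e. it induces a well-defined endomorphism $T_N$ of the abelian group $\mathbb{Z}\lambda(\mathrm{SL}_2(\mathbb{Z}))$. The operators $T_N$ and $T_M$ commute when $M$ and $N$ are relatively prime. These actions of the $T_N$ descend to $\mathbb{Z}\lambda(\mathrm{PSL}_2(\mathbb{Z}))$ along the natural surjection $\mathbb{Z}\lambda(\mathrm{SL}_2(\mathbb{Z}))\to \mathbb{Z}\lambda(\mathrm{PSL}_2(\mathbb{Z}))$.
   Context: For a group $\Gamma$, $\lambda(\Gamma)$ is its set of conjugacy classes and $\mathbb{Z}\lambda(\Gamma)$ the free abelian group on $\lambda(\Gamma)$. A homomorphism $\psi:\Gamma\to\Gamma'$ induces $\psi_*:\mathbb{Z}\lambda(\Gamma)\to\mathbb{Z}\lambda(\Gamma')$. If $\pi:\Gamma'\hookrightarrow\Gamma$ is the inclusion of a finite index subgroup, the pullback $\pi^*:\mathbb{Z}\lambda(\Gamma)\to\mathbb{Z}\lambda(\Gamma')$ sends the class of $\alpha$ to $\sum_{s}[\gamma_s\alpha^{d_s}\gamma_s^{-1}]$, where $s$ ranges over $\Gamma'\backslash\Gamma/\langle\alpha\rangle$, $\gamma_s$ is a representative of $s$, and $d_s=\min\{k>0:\gamma_s\alpha^k\gamma_s^{-1}\in\Gamma'\}$. (Topologically: a loop is sent to the sum of the closed loops covering it in the finite covering corresponding to $\Gamma'$.) The Hecke correspondence $T_N$ is the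 correspondence $\mathcal{M}_{1,1}\xleftarrow{\pi_N}\mathrm{Cov}_N\xrightarrow{\pi_N^{op}}\mathcal{M}_{1,1}$, where $\mathcal{M}_{1,1}$ is the orbifold $\mathrm{SL}_2(\mathbb{Z})\backslash\mathfrak{h}$ of lattices in $\mathbb{C}$ modulo scaling, $\mathrm{Cov}_N$ is the orbifold of pairs $(\Lambda\supset\Lambda')$ of lattices in $\mathbb{C}$ with $[\Lambda:\Lambda']=N$, modulo scaling, $\pi_N(\Lambda,\Lambda')=\Lambda$, $\pi_N^{op}(\Lambda,\Lambda')=\Lambda'$; the induced operator is $T_N=(\pi_N^{op})_*\circ\pi_N^*$ (summing over connected components of $\mathrm{Cov}_N$). Concretely: let $\mathrm{SL}_2(\mathbb{Z})$ act on row vectors $\mathbb{Z}^2$ on the right. For a sublattice $L\subset\mathbb{Z}^2$ of index $N$ let $\Gamma_L=\{\gamma\in\mathrm{SL}_2(\mathbb{Z}):L\gamma=L\}$ with inclusion $\pi_L:\Gamma_L\hookrightarrow\mathrm{SL}_2(\mathbb{Z})$, choose an integer matrix $A_L$ with $\det A_L=N$ and $L=\mathbb{Z}^2A_L$, and let $\psi_L:\Gamma_L\to\mathrm{SL}_2(\mathbb{Z})$, $\gamma\mapsto A_L\gamma A_L^{-1}$. Then $T_N=\sum_L(\psi_L)_*\circ\pi_L^*$, with $L$ ranging over representatives of the $\mathrm{SL}_2(\mathbb{Z})$-orbits of index $N$ sublattices. *)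

theory Defs
  imports
    "HOL-Analysis.Determinants"
    "HOL-Algebra.Coset"
    "HOL-Algebra.Generated_Groups"
    "HOL-Algebra.Free_Abelian_Groups"
begin

section \<open>Conjugacy classes, induced maps and pullbacks\<close>

definition conj_class :: "('a, 'm) monoid_scheme \<Rightarrow> 'a \<Rightarrow> 'a set" where
  "conj_class G x = {g \<otimes>\<^bsub>G\<^esub> x \<otimes>\<^bsub>G\<^esub> inv\<^bsub>G\<^esub> g | g. g \<in> carrier G}"

definition conj_classes :: "('a, 'm) monoid_scheme \<Rightarrow> 'a set set" where
  "conj_classes G = conj_class G ` carrier G"

definition Zlambda :: "('a, 'm) monoid_scheme \<Rightarrow> ('a set \<Rightarrow>\<^sub>0 int) monoid" where
  "Zlambda G = free_Abelian_group (conj_classes G)"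

text \<open>For a homomorphism \<open>\<psi>\<close> the image of a class \<open>C\<close> lies in exactly one class of the target;
  see \<open>induced_map_frag_of\<close> below.\<close>

definition induced_map ::
    "('a, 'm) monoid_scheme \<Rightarrow> ('b, 'n) monoid_scheme \<Rightarrow> ('a \<Rightarrow> 'b) \<Rightarrow> ('a set \<Rightarrow>\<^sub>0 int) \<Rightarrow> ('b set \<Rightarrow>\<^sub>0 int)" where
  "induced_map G G' \<psi> = frag_extend (\<lambda>C. frag_of (THE D. D \<in> conj_classes G' \<and> \<psi> ` C \<subseteq> D))"

text \<open>\<open>H\<setminus>G/\<langle>\<alpha>\<rangle>\<close>\<close>

definition double_cosets :: "('a, 'm) monoid_scheme \<Rightarrow> 'a set \<Rightarrow> 'a \<Rightarrow> 'a set set" where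
  "double_cosets G H \<alpha> = (\<lambda>g. (H #>\<^bsub>G\<^esub> g) <#>\<^bsub>G\<^esub> generate G {\<alpha>}) ` carrier G"

definition return_time :: "('a, 'm) monoid_scheme \<Rightarrow> 'a set \<Rightarrow> 'a \<Rightarrow> 'a \<Rightarrow> nat" where
  "return_time G H \<alpha> \<gamma> =
     (LEAST k. 0 < k \<and> \<gamma> \<otimes>\<^bsub>G\<^esub> (\<alpha> [^]\<^bsub>G\<^esub> k) \<otimes>\<^bsub>G\<^esub> inv\<^bsub>G\<^esub> \<gamma> \<in> H)"

text \<open>The pullback of the class of \<open>\<alpha>\<close>, computed with the representative \<open>\<alpha>\<close> of its class and the
  representatives \<open>\<gamma> s\<close> of the double cosets \<open>s\<close>.\<close>

definition pullback_sum ::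
    "('a, 'm) monoid_scheme \<Rightarrow> 'a set \<Rightarrow> 'a \<Rightarrow> ('a set \<Rightarrow> 'a) \<Rightarrow> ('a set \<Rightarrow>\<^sub>0 int)" where
  "pullback_sum G H \<alpha> \<gamma> =
     (\<Sum>s\<in>double_cosets G H \<alpha>.
        frag_of (conj_class (G\<lparr>carrier := H\<rparr>)
          (\<gamma> s \<otimes>\<^bsub>G\<^esub> (\<alpha> [^]\<^bsub>G\<^esub> return_time G H \<alpha> (\<gamma> s)) \<otimes>\<^bsub>G\<^esub> inv\<^bsub>G\<^esub> (\<gamma> s))))"

definition pullback ::
    "('a, 'm) monoid_scheme \<Rightarrow> 'a set \<Rightarrow> ('a set \<Rightarrow>\<^sub>0 int) \<Rightarrow> ('a set \<Rightarrow>\<^sub>0 int)" where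
  "pullback G H =
     frag_extend (\<lambda>C. pullback_sum G H (SOME \<alpha>. \<alpha> \<in> C) (\<lambda>s. SOME \<gamma>. \<gamma> \<in> s))"


section \<open>The modular group\<close>

definition SL2Z :: "(int^2^2) monoid" where
  "SL2Z = \<lparr>carrier = {A. det A = 1}, monoid.mult = (**), one = mat 1\<rparr>"

definition PSL2Z :: "(int^2^2) set monoid" where
  "PSL2Z = SL2Z Mod {mat 1, - mat 1}"

definition proj_PSL2Z :: "int^2^2 \<Rightarrow> (int^2^2) set" where
  "proj_PSL2Z \<gamma> = {mat 1, - mat 1} #>\<^bsub>SL2Z\<^esub> \<gamma>"


section \<open>The Hecke operators\<close>

definition Z2 :: "(int^2) monoid" where
  "Z2 = \<lparr>carrier = UNIV, monoid.mult = (+), one = 0\<rparr>"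

text \<open>For \<open>N = 0\<close> this would describe the sublattices of infinite index.\<close>

definition sublattices :: "nat \<Rightarrow> (int^2) set set" where
  "sublattices N = {L. subgroup L Z2 \<and> card (rcosets\<^bsub>Z2\<^esub> L) = N}"

definition lattice_act :: "(int^2) set \<Rightarrow> int^2^2 \<Rightarrow> (int^2) set" where
  "lattice_act L \<gamma> = (\<lambda>v. v v* \<gamma>) ` L"

definition lattice_stab :: "(int^2) set \<Rightarrow> (int^2^2) set" where
  "lattice_stab L = {\<gamma> \<in> carrier SL2Z. lattice_act L \<gamma> = L}"

abbreviation stab_group :: "(int^2) set \<Rightarrow> (int^2^2) monoid" where
  "stab_group L \<equiv> SL2Z\<lparr>carrier := lattice_stab L\<rparr>"

definition is_lattice_matrix :: "nat \<Rightarrow> (int^2) set \<Rightarrow> int^2^2 \<Rightarrow> bool" where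
  "is_lattice_matrix N L A \<longleftrightarrow> det A = int N \<and> L = range (\<lambda>v. v v* A)"

definition rat_matrix :: "int^2^2 \<Rightarrow> rat^2^2" where
  "rat_matrix = map_matrix of_int"

definition rat_conj :: "int^2^2 \<Rightarrow> int^2^2 \<Rightarrow> rat^2^2" where
  "rat_conj A \<gamma> = rat_matrix A ** rat_matrix \<gamma> ** matrix_inv (rat_matrix A)"

text \<open>The integer matrix \<open>A \<gamma> A\<^sup>-\<^sup>1\<close>; it exists only when \<open>rat_conj A \<gamma>\<close> has integral entries.\<close>

definition hecke_conj :: "int^2^2 \<Rightarrow> int^2^2 \<Rightarrow> int^2^2" where
  "hecke_conj A \<gamma> = (THE B. rat_matrix B = rat_conj A \<gamma>)"

text \<open>The choices entering the definition of the operator: a set \<open>R\<close> of representatives of the orbits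
  of sublattices of index \<open>N\<close>, and a matrix \<open>A L\<close> for each of them.\<close>

definition hecke_choice :: "nat \<Rightarrow> (int^2) set set \<Rightarrow> ((int^2) set \<Rightarrow> int^2^2) \<Rightarrow> bool" where
  "hecke_choice N R A \<longleftrightarrow>
     R \<subseteq> sublattices N \<and>
     (\<forall>L\<in>sublattices N. \<exists>!L'. L' \<in> R \<and> (\<exists>\<gamma>\<in>carrier SL2Z. L' = lattice_act L \<gamma>)) \<and>
     (\<forall>L\<in>R. is_lattice_matrix N L (A L))"

definition hecke_sum ::
    "(int^2) set set \<Rightarrow> ((int^2) set \<Rightarrow> int^2^2) \<Rightarrow> ((int^2^2) set \<Rightarrow>\<^sub>0 int) \<Rightarrow> ((int^2^2) set \<Rightarrow>\<^sub>0 int)" where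
  "hecke_sum R A z =
     (\<Sum>L\<in>R. induced_map (stab_group L) SL2Z (hecke_conj (A L)) (pullback SL2Z (lattice_stab L) z))"

definition hecke :: "nat \<Rightarrow> ((int^2^2) set \<Rightarrow>\<^sub>0 int) \<Rightarrow> ((int^2^2) set \<Rightarrow>\<^sub>0 int)" where
  "hecke N = (let (R, A) = (SOME (R, A). hecke_choice N R A) in hecke_sum R A)"


section \<open>Basic facts\<close>

lemma (in group) conj_class_conj:
  assumes "x \<in> carrier G" "g \<in> carrier G"
  shows "conj_class G (g \<otimes> x \<otimes> inv g) = conj_class G x"
proof -
  have "h \<otimes> (g \<otimes> x \<otimes> inv g) \<otimes> inv h = (h \<otimes> g) \<otimes> x \<otimes> inv (h \<otimes> g)" if "h \<in> carrier G" for h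
    using that assms by (simp add: m_assoc inv_mult_group)
  moreover have "h \<otimes> x \<otimes> inv h = (h \<otimes> inv g) \<otimes> (g \<otimes> x \<otimes> inv g) \<otimes> inv (h \<otimes> inv g)"
    if "h \<in> carrier G" for h
  proof -
    have "inv g \<otimes> (g \<otimes> y) = y" if "y \<in> carrier G" for y
      using that assms by (simp flip: m_assoc)
    then show ?thesis
      using that assms by (simp add: m_assoc inv_mult_group)
  qed
  ultimately show ?thesis
    unfolding conj_class_def using assms by (blast intro: m_closed inv_closed)
qed

lemma (in group) conj_class_self: "x \<in> carrier G \<Longrightarrow> x \<in> conj_class G x"
  unfolding conj_class_def by (force intro: exI[of _ \<one>])

lemma induced_map_frag_of:
  assumes "group G" "group G'" "\<psi> \<in> hom G G'" "x \<in> carrier G"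
  shows "induced_map G G' \<psi> (frag_of (conj_class G x)) = frag_of (conj_class G' (\<psi> x))"
proof -
  interpret group_hom G G' \<psi>
    using assms by (simp add: group_hom_def group_hom_axioms_def)
  have "(THE D. D \<in> conj_classes G' \<and> \<psi> ` conj_class G x \<subseteq> D) = conj_class G' (\<psi> x)"
  proof (rule the_equality)
    have "\<psi> ` conj_class G x \<subseteq> conj_class G' (\<psi> x)"
      unfolding conj_class_def using assms(4) by auto
    then show "conj_class G' (\<psi> x) \<in> conj_classes G' \<and> \<psi> ` conj_class G x \<subseteq> conj_class G' (\<psi> x)"
      using assms(4) by (auto simp: conj_classes_def)
  next
    fix D assume D: "D \<in> conj_classes G' \<and> \<psi> ` conj_class G x \<subseteq> D"
    then obtain y where y: "y \<in> carrier G'" "D = conj_class G' y"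
      by (auto simp: conj_classes_def)
    have "\<psi> x \<in> D"
      using D assms(4) G.conj_class_self by blast
    then obtain g where "g \<in> carrier G'" "\<psi> x = g \<otimes>\<^bsub>G'\<^esub> y \<otimes>\<^bsub>G'\<^esub> inv\<^bsub>G'\<^esub> g"
      using y by (auto simp: conj_class_def)
    then show "D = conj_class G' (\<psi> x)"
      using y H.conj_class_conj by simp
  qed
  then show ?thesis
    by (simp add: induced_map_def)
qed

lemma group_SL2Z: "group SL2Z"
proof (rule groupI)
  fix A assume A: "A \<in> carrier SL2Z"
  define B :: "int^2^2" where "B = vector [vector [A$2$2, - (A$1$2)], vector [- (A$2$1), A$1$1]]"
  have "det B = 1" "B ** A = mat 1"
    using A by (auto simp: SL2Z_def B_def det_2 matrix_matrix_mult_def mat_def vec_eq_iff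
        forall_2 sum_2 vector_2 algebra_simps)
  then show "\<exists>B\<in>carrier SL2Z. B \<otimes>\<^bsub>SL2Z\<^esub> A = \<one>\<^bsub>SL2Z\<^esub>"
    by (auto simp: SL2Z_def)
qed (auto simp: SL2Z_def det_mul matrix_mul_assoc)

lemma normal_center_SL2Z: "{mat 1, - mat 1} \<lhd> SL2Z"
proof -
  interpret group SL2Z by (rule group_SL2Z)
  have mult: "(- mat 1) ** x = - x" "x ** (- mat 1) = - x" for x :: "int^2^2"
    by (auto simp: matrix_matrix_mult_def mat_def vec_eq_iff forall_2 sum_2)
  have det: "det (- mat 1 :: int^2^2) = 1"
    by (simp add: det_2 mat_def)
  have inv: "inv\<^bsub>SL2Z\<^esub> (- mat 1) = - mat 1"
    by (rule inv_equality) (auto simp: SL2Z_def mult det)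
  have one: "inv\<^bsub>SL2Z\<^esub> mat 1 = mat 1"
    using inv_one by (simp add: SL2Z_def)
  have sub: "subgroup {mat 1, - mat 1} SL2Z"
    by (rule subgroupI) (auto simp: inv one, auto simp: SL2Z_def mult det)
  show ?thesis
    by (rule normalI[OF sub]) (auto simp: r_coset_def l_coset_def SL2Z_def mult)
qed

end

theory Submission
  imports Defs
begin

text \<open>A sublattice \<open>L\<close> of index \<open>N\<close> has a finite period \<open>d\<close> under \<open>\<alpha>\<close> and a well defined class
  \<open>[A\<^sub>L \<alpha>\<^sup>d A\<^sub>L\<^sup>-\<^sup>1]\<close>. Double cosets are orbits, so \<open>T\<^sub>N [\<alpha>]\<close> is the sum of these classes over the
  \<open>\<alpha>\<close>-orbits of sublattices, or equivalently, after pairing with an arbitrary real-valued function on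
  classes, the sum over all sublattices weighted by \<open>1/d\<close>. In this form no choices are left. The
  composite \<open>T\<^sub>M T\<^sub>N\<close> is the same kind of sum over chains \<open>L' \<subseteq> L\<close>, because periods multiply; for
  coprime \<open>M\<close>, \<open>N\<close> the chain is determined by \<open>L'\<close>, since \<open>L = {v. M v \<in> L'}\<close>, and hence
  \<open>T\<^sub>M T\<^sub>N = T\<^sub>M\<^sub>N\<close>. Finally \<open>-1\<close> fixes every sublattice, so \<open>\<alpha>\<close> and \<open>-\<alpha>\<close> have the same periods and
  their classes agree up to sign.\<close>

section \<open>Pairing formal sums with functions\<close>

text \<open>An integral formal sum cannot carry the weight 1/d, hence the detour through real-valued
  functions; indicator functions of single classes recover every coefficient, so nothing is lost.
  The choices disappear for four different reasons. Replacing \<alpha> by a conjugate only permutes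
  the cosets of the stabiliser by a right translation. Representatives of one double coset give
  loops conjugate inside the stabiliser. Cosets of the stabiliser of L correspond to the lattices in
  the orbit of L, so the base lattice L is forgotten. Two matrices of one lattice differ by a left
  factor in SL2(Z), which only conjugates the result. Coprimality is needed for more than the count
  of chains: as L is defined from L' alone, a power of \<alpha> that fixes L' also fixes L, and this
  makes the period of L' the product of the two periods of the chain. For M = N = p prime it fails:
  p Z^2 has index p^2 and lies in p + 1 lattices of index p. Conjugation by A_L is always handled in
  the form B A = A g, which keeps the computations integral.\<close>

definition frag_eval :: "('a \<Rightarrow> real) \<Rightarrow> ('a \<Rightarrow>\<^sub>0 int) \<Rightarrow> real" where
  "frag_eval f z = (\<Sum>c\<in>Poly_Mapping.keys z. of_int (Poly_Mapping.lookup z c) * f c)"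

text \<open>Keys outside the support contribute 0; this allows sums with different supports to be
  written over one common index set.\<close>

lemma frag_eval_superset:
  assumes "finite S" "Poly_Mapping.keys z \<subseteq> S"
  shows "frag_eval f z = (\<Sum>c\<in>S. of_int (Poly_Mapping.lookup z c) * f c)"
  unfolding frag_eval_def
  by (rule sum.mono_neutral_left) (use assms in \<open>auto simp: in_keys_iff\<close>)

lemma frag_eval_0 [simp]: "frag_eval f 0 = 0"
  by (simp add: frag_eval_def)

lemma frag_eval_frag_of [simp]: "frag_eval f (frag_of c) = f c"
  by (simp add: frag_eval_def)

lemma frag_eval_add: "frag_eval f (x + y) = frag_eval f x + frag_eval f y"
  and frag_eval_diff: "frag_eval f (x - y) = frag_eval f x - frag_eval f y"
proof -
  let ?S = "Poly_Mapping.keys x \<union> Poly_Mapping.keys y"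
  note sup = frag_eval_superset[of ?S _ f]
  show "frag_eval f (x + y) = frag_eval f x + frag_eval f y"
    using keys_add[of x y]
    by (simp add: sup lookup_add ring_distribs flip: sum.distrib)
  show "frag_eval f (x - y) = frag_eval f x - frag_eval f y"
    using keys_diff[of x y]
    by (simp add: sup lookup_minus ring_distribs flip: sum_subtractf)
qed

lemma frag_eval_sum: "frag_eval f (\<Sum>i\<in>I. x i) = (\<Sum>i\<in>I. frag_eval f (x i))"
  by (induction I rule: infinite_finite_induct) (auto simp: frag_eval_add)

lemma frag_eval_frag_extend:
  "frag_eval f (frag_extend b z) = frag_eval (\<lambda>c. frag_eval f (b c)) z"
  using subset_UNIV
  by (induction z rule: frag_induction) (auto simp: frag_extend_diff frag_eval_diff)

text \<open>Pairing with the indicator function of \<open>c\<close> reads off the coefficient at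
  \<open>c\<close>.\<close>

lemma frag_eqI:
  fixes x y :: "'a \<Rightarrow>\<^sub>0 int"
  assumes "\<And>f. frag_eval f x = frag_eval f y"
  shows "x = y"
proof (rule poly_mapping_eqI)
  fix c
  have "frag_eval (\<lambda>d::'a. if d = c then 1 else 0) z = of_int (Poly_Mapping.lookup z c)" for z
  proof -
    \<comment> \<open>\<open>c\<close> need not be a key of \<open>z\<close>, so it is added to the
      index set before the indicator picks it out.\<close>
    let ?S = "insert c (Poly_Mapping.keys z)"
    have "frag_eval (\<lambda>d::'a. if d = c then 1 else 0) z
        = (\<Sum>d\<in>?S. of_int (Poly_Mapping.lookup z d) * (if d = c then 1 else 0))"
      by (rule frag_eval_superset) auto
    also have "\<dots> = (\<Sum>d\<in>?S. if d = c then of_int (Poly_Mapping.lookup z d) else 0)"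
      by (rule sum.cong) auto
    also have "\<dots> = of_int (Poly_Mapping.lookup z c)"
      by (subst sum.delta) auto
    finally show ?thesis .
  qed
  then show "Poly_Mapping.lookup x c = Poly_Mapping.lookup y c"
    using assms[of "\<lambda>d. if d = c then 1 else 0"] by simp
qed

text \<open>A fibre of \<open>D\<close> with n elements contributes n times the n-th part of its
  value. Applied with fibres equal to orbits, it trades a sum over orbits for a sum over
  points.\<close>

lemma sum_image_weighted:
  fixes F :: "'b \<Rightarrow> real"
  assumes "finite X"
  shows "(\<Sum>s\<in>D ` X. F s) = (\<Sum>x\<in>X. F (D x) / card {y\<in>X. D y = D x})"
proof -
  have "(\<Sum>x\<in>X. F (D x) / card {y\<in>X. D y = D x})
      = (\<Sum>s\<in>D ` X. \<Sum>x\<in>{x\<in>X. D x = s}. F (D x) / card {y\<in>X. D y = D x})"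
    by (rule sum.image_gen[OF assms])
  also have "\<dots> = (\<Sum>s\<in>D ` X. F s)"
  proof (rule sum.cong[OF refl])
    fix s assume "s \<in> D ` X"
    then have "card {x\<in>X. D x = s} \<noteq> 0"
      using assms by auto
    moreover have "(\<Sum>x\<in>{x\<in>X. D x = s}. F (D x) / card {y\<in>X. D y = D x})
        = (\<Sum>x\<in>{x\<in>X. D x = s}. F s / card {x\<in>X. D x = s})"
      by (rule sum.cong) auto
    ultimately show "(\<Sum>x\<in>{x\<in>X. D x = s}. F (D x) / card {y\<in>X. D y = D x}) = F s"
      by simp
  qed
  finally show ?thesis ..
qed

section \<open>Pullbacks as weighted sums over cosets\<close>

context group
begin

section \<open>Conjugation, powers and return times\<close>

lemma inv_cancel: "g \<in> carrier G \<Longrightarrow> y \<in> carrier G \<Longrightarrow> inv g \<otimes> (g \<otimes> y) = y"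
  by (simp flip: m_assoc)

lemma conj_int_pow:
  assumes "a \<in> carrier G" "g \<in> carrier G"
  shows "(g \<otimes> a \<otimes> inv g) [^] (k::int) = g \<otimes> a [^] k \<otimes> inv g"
proof -
  have nat: "(g \<otimes> b \<otimes> inv g) [^] (n::nat) = g \<otimes> b [^] n \<otimes> inv g" if "b \<in> carrier G" for n b
  proof (induction n)
    case 0
    then show ?case using assms by simp
  next
    case (Suc n)
    have "(g \<otimes> b \<otimes> inv g) [^] Suc n = (g \<otimes> b [^] n \<otimes> inv g) \<otimes> (g \<otimes> b \<otimes> inv g)"
      using Suc by simp
    also have "\<dots> = g \<otimes> (b [^] n \<otimes> (b \<otimes> inv g))"
      using that assms inv_cancel[OF assms(2)] by (simp add: m_assoc)
    also have "\<dots> = g \<otimes> b [^] Suc n \<otimes> inv g"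
      using that assms by (simp add: m_assoc)
    finally show ?case .
  qed
  show ?thesis
  proof (cases k rule: int_cases2)
    case (nonneg n)
    then show ?thesis using nat[OF assms(1)] by (simp add: int_pow_int)
  next
    case (nonpos n)
    have "inv (g \<otimes> a [^] n \<otimes> inv g) = g \<otimes> inv (a [^] n) \<otimes> inv g"
      using assms by (simp add: inv_mult_group m_assoc)
    then show ?thesis using nonpos nat[OF assms(1), of n] assms by (simp add: int_pow_neg_int)
  qed
qed

lemma conj_nat_pow:
  assumes "a \<in> carrier G" "g \<in> carrier G"
  shows "(g \<otimes> a \<otimes> inv g) [^] (k::nat) = g \<otimes> a [^] k \<otimes> inv g"
  using conj_int_pow[OF assms, of "int k"] by (simp add: int_pow_int)

lemma conj_conj:
  assumes "a \<in> carrier G" "g \<in> carrier G" "h \<in> carrier G"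
  shows "h \<otimes> (g \<otimes> a \<otimes> inv g) \<otimes> inv h = (h \<otimes> g) \<otimes> a \<otimes> inv (h \<otimes> g)"
  using assms by (simp add: m_assoc inv_mult_group)

lemma conj_mem_subgroup_iff:
  assumes "subgroup H G" "x \<in> carrier G" "h \<in> H"
  shows "h \<otimes> x \<otimes> inv h \<in> H \<longleftrightarrow> x \<in> H"
proof
  note closed = subgroup.m_closed[OF assms(1)] subgroup.m_inv_closed[OF assms(1)]
  have h: "h \<in> carrier G" using assms subgroup.mem_carrier by fast
  assume "h \<otimes> x \<otimes> inv h \<in> H"
  then have "inv h \<otimes> (h \<otimes> x \<otimes> inv h) \<otimes> h \<in> H"
    using assms(3) closed(1)[OF closed(1)[OF closed(2)]] by blast
  also have "inv h \<otimes> (h \<otimes> x \<otimes> inv h) \<otimes> h = x"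
    using h assms(2) inv_cancel[OF h assms(2)] by (simp add: m_assoc)
  finally show "x \<in> H" .
next
  assume "x \<in> H"
  then show "h \<otimes> x \<otimes> inv h \<in> H"
    using assms(3) by (intro subgroup.m_closed[OF assms(1)] subgroup.m_inv_closed[OF assms(1)])
qed

lemma return_time:
  assumes H: "subgroup H G" and fin: "finite (rcosets H)"
    and a: "a \<in> carrier G" and g: "g \<in> carrier G"
  shows "0 < return_time G H a g"
    and "g \<otimes> a [^] (k::int) \<otimes> inv g \<in> H \<longleftrightarrow> int (return_time G H a g) dvd k"
proof -
  define b where "b = g \<otimes> a \<otimes> inv g"
  have b: "b \<in> carrier G" using a g by (simp add: b_def)
  define d where "d = return_time G H a g"
  have d: "d = (LEAST k. 0 < k \<and> b [^] k \<in> H)"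
    unfolding d_def return_time_def b_def using conj_nat_pow[OF a g] by simp
  \<comment> \<open>Pigeonhole: infinitely many exponents, finitely many cosets. A coincidence for i
    < j puts the power with exponent j - i into \<open>H\<close>.\<close>
  have "\<not> inj_on (\<lambda>k. H #> b [^] k) (UNIV :: nat set)"
  proof
    assume "inj_on (\<lambda>k. H #> b [^] k) (UNIV :: nat set)"
    moreover have "range (\<lambda>k::nat. H #> b [^] k) \<subseteq> rcosets H"
      using b subgroup.subset[OF H] by (auto intro!: rcosetsI)
    ultimately show False
      using fin finite_subset finite_imageD infinite_UNIV_nat by metis
  qed
  then obtain i j :: nat where "i \<noteq> j" "H #> b [^] i = H #> b [^] j"
    by (auto simp: inj_on_def)
  then obtain i j :: nat where ij: "i < j" "H #> b [^] i = H #> b [^] j"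
    by (metis nat_neq_iff)
  have "b [^] j \<in> H #> b [^] i"
    using repr_independenceD[OF H] ij(2) b by simp
  then obtain h where h: "h \<in> H" "b [^] j = h \<otimes> b [^] i"
    by (auto simp: r_coset_def)
  have "b [^] (j - i) \<otimes> b [^] i = b [^] j"
    using ij b by (simp add: nat_pow_mult)
  then have "b [^] (j - i) = h"
    using h b H subgroup.mem_carrier by (metis nat_pow_closed right_cancel)
  then have "\<exists>k>0. b [^] (k::nat) \<in> H"
    using h ij by (intro exI[of _ "j - i"]) auto
  then have dpos: "0 < d" and bd: "b [^] d \<in> H"
    unfolding d by (rule LeastI2_ex; blast)+
  show "0 < return_time G H a g" using dpos by (simp add: d_def)
  have mult: "b [^] (int d * q) \<in> H" for q
  proof -
    have "b [^] (int d * q) = (b [^] int d) [^] q" using b by (simp add: int_pow_pow)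
    then show ?thesis using subgroup_int_pow_closed[OF H bd] by (simp add: int_pow_int)
  qed
  have "b [^] k \<in> H \<longleftrightarrow> int d dvd k"
  proof
    assume k: "b [^] k \<in> H"
    \<comment> \<open>Division with remainder: the remainder is again such an exponent and is
      smaller than \<open>d\<close>, so minimality makes it 0.\<close>
    have "b [^] (k mod int d) = b [^] k \<otimes> inv (b [^] (int d * (k div int d)))"
      using int_pow_diff[OF b, of k "int d * (k div int d)"] by (simp add: minus_mult_div_eq_mod)
    then have "b [^] (k mod int d) \<in> H"
      using k mult by (simp add: subgroup.m_closed[OF H] subgroup.m_inv_closed[OF H])
    then have "b [^] int (nat (k mod int d)) \<in> H"
      using dpos by simp
    then have "b [^] nat (k mod int d) \<in> H"
      by (simp only: int_pow_int)
    moreover have "nat (k mod int d) < d"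
      using dpos by (simp add: nat_less_iff)
    ultimately have "\<not> 0 < nat (k mod int d)"
      using not_less_Least[of "nat (k mod int d)" "\<lambda>k. 0 < k \<and> b [^] k \<in> H"] by (simp only: d[symmetric]) simp
    then show "int d dvd k"
      using dpos pos_mod_sign[of "int d" k] unfolding dvd_eq_mod_eq_0 by linarith
  qed (auto intro: mult)
  then show "g \<otimes> a [^] (k::int) \<otimes> inv g \<in> H \<longleftrightarrow> int (return_time G H a g) dvd k"
    using conj_int_pow[OF a g] by (simp add: d_def b_def)
qed

lemma return_time_nat:
  assumes "subgroup H G" "finite (rcosets H)" "a \<in> carrier G" "g \<in> carrier G"
  shows "g \<otimes> a [^] (k::nat) \<otimes> inv g \<in> H \<longleftrightarrow> return_time G H a g dvd k"
  using return_time(2)[OF assms, of "int k"] by (simp add: int_pow_int)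

text \<open>In the covering picture this is the closed loop over \<open>a\<close> through the sheet
  of the coset of \<open>g\<close>. The class is taken in \<open>H\<close>, not in the whole
  group.\<close>

definition loop_class :: "'a set \<Rightarrow> 'a \<Rightarrow> 'a \<Rightarrow> 'a set" where
  "loop_class H a g = conj_class (G\<lparr>carrier := H\<rparr>) (g \<otimes> a [^] return_time G H a g \<otimes> inv g)"

lemma loop_mem:
  assumes "subgroup H G" "finite (rcosets H)" "a \<in> carrier G" "g \<in> carrier G"
  shows "g \<otimes> a [^] return_time G H a g \<otimes> inv g \<in> H"
  using return_time_nat[OF assms] by simp

text \<open>A power of \<open>a\<close> commutes with all powers of \<open>a\<close> and drops out
  of the conjugation; the factor \<open>h\<close> merely conjugates inside \<open>H\<close>. Hence
  both quantities depend on the double coset only.\<close>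

lemma loop_translate:
  assumes H: "subgroup H G" and fin: "finite (rcosets H)"
    and a: "a \<in> carrier G" and g: "g \<in> carrier G" and h: "h \<in> H"
  shows "return_time G H a (h \<otimes> g \<otimes> a [^] (k::int)) = return_time G H a g"
    and "loop_class H a (h \<otimes> g \<otimes> a [^] k) = loop_class H a g"
proof -
  have hc: "h \<in> carrier G" using h H subgroup.mem_carrier by fast
  have comm: "a [^] k \<otimes> a [^] n \<otimes> inv (a [^] k) = a [^] n" for n :: nat
  proof -
    have "a [^] k \<otimes> a [^] int n \<otimes> inv (a [^] k) = a [^] int n"
      using a by (simp flip: int_pow_mult int_pow_diff)
    then show ?thesis by (simp add: int_pow_int)
  qed
  have eq: "(h \<otimes> g \<otimes> a [^] k) \<otimes> a [^] n \<otimes> inv (h \<otimes> g \<otimes> a [^] k) = h \<otimes> (g \<otimes> a [^] n \<otimes> inv g) \<otimes> inv h"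
    for n :: nat
    using comm a g hc by (simp flip: conj_conj)
  show rt: "return_time G H a (h \<otimes> g \<otimes> a [^] k) = return_time G H a g"
    unfolding return_time_def eq using conj_mem_subgroup_iff[OF H _ h] a g by simp
  have "h \<otimes> x \<otimes> inv h = h \<otimes>\<^bsub>G\<lparr>carrier := H\<rparr>\<^esub> x \<otimes>\<^bsub>G\<lparr>carrier := H\<rparr>\<^esub> inv\<^bsub>G\<lparr>carrier := H\<rparr>\<^esub> h" for x
    using m_inv_consistent[OF H h] by simp
  then show "loop_class H a (h \<otimes> g \<otimes> a [^] k) = loop_class H a g"
    unfolding loop_class_def rt eq
    using group.conj_class_conj[OF subgroup_imp_group[OF H]] loop_mem[OF H fin a g] h by simp
qed

section \<open>Double cosets as orbits on the right cosets\<close>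

lemma mem_double_coset_iff:
  assumes "subgroup H G" "a \<in> carrier G" "g \<in> carrier G"
  shows "x \<in> (H #> g) <#> generate G {a} \<longleftrightarrow> (\<exists>h\<in>H. \<exists>k::int. x = h \<otimes> g \<otimes> a [^] k)"
  unfolding set_mult_def r_coset_def generate_pow[OF assms(2)] by blast

lemma double_cosets_eq_image:
  "double_cosets G H a = (\<lambda>c. c <#> generate G {a}) ` (rcosets H)"
  unfolding double_cosets_def RCOSETS_def by auto

text \<open>The orbit consists of the cosets of g a^k, and the exponents i and j give the same coset
  exactly if the return time divides i - j; the exponents below the return time therefore list it
  without repetition.\<close>

lemma card_orbit_coset:
  assumes H: "subgroup H G" and fin: "finite (rcosets H)"
    and a: "a \<in> carrier G" and g: "g \<in> carrier G"
  shows "card {c\<in>rcosets H. c <#> generate G {a} = (H #> g) <#> generate G {a}} = return_time G H a g"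
    (is "card ?X = ?d")
proof -
  have sub: "H \<subseteq> carrier G" using H by (rule subgroup.subset)
  have cos: "H #> (g \<otimes> a [^] i) = H #> (g \<otimes> a [^] j) \<longleftrightarrow> int ?d dvd i - j" for i j :: int
  proof -
    have "g \<otimes> a [^] (i - j) \<otimes> inv g = (g \<otimes> a [^] i) \<otimes> inv (g \<otimes> a [^] j)"
      using a g by (simp add: int_pow_diff inv_mult_group m_assoc)
    moreover have "H #> (g \<otimes> a [^] i) = H #> (g \<otimes> a [^] j) \<longleftrightarrow> (g \<otimes> a [^] i) \<otimes> inv (g \<otimes> a [^] j) \<in> H"
      using a g coset_mult_inv1[OF _ _ _ sub] coset_mult_inv2[OF _ _ _ sub] coset_join1[OF _ _ H]
        coset_join2[OF _ H] by (metis inv_closed int_pow_closed m_closed)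
    ultimately show ?thesis using return_time(2)[OF H fin a g, of "i - j"] by simp
  qed
  have "bij_betw (\<lambda>k. H #> (g \<otimes> a [^] int k)) {..<?d} ?X"
    unfolding bij_betw_def
  proof (intro conjI equalityI subsetI)
    show "inj_on (\<lambda>k. H #> (g \<otimes> a [^] int k)) {..<?d}"
    proof (rule inj_onI)
      fix i j assume "i \<in> {..<?d}" "j \<in> {..<?d}" "H #> (g \<otimes> a [^] int i) = H #> (g \<otimes> a [^] int j)"
      then have "int ?d dvd int i - int j" "i < ?d" "j < ?d"
        by (simp_all add: cos)
      then have "int i mod int ?d = int j mod int ?d" "i < ?d" "j < ?d"
        by (simp_all only: mod_eq_dvd_iff)
      then show "i = j" by simp
    qed
  next
    fix c assume "c \<in> (\<lambda>k. H #> (g \<otimes> a [^] int k)) ` {..<?d}"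
    then obtain k where c: "c = H #> (g \<otimes> a [^] int k)" by auto
    have "x \<in> c <#> generate G {a} \<longleftrightarrow> x \<in> (H #> g) <#> generate G {a}" for x
    proof -
      have eq: "h \<otimes> (g \<otimes> a [^] int k) \<otimes> a [^] j = h \<otimes> g \<otimes> a [^] (int k + j)" if "h \<in> H" for h j
        using that sub a g by (simp add: int_pow_mult m_assoc subset_iff)
      show ?thesis
        unfolding c mem_double_coset_iff[OF H a g] mem_double_coset_iff[OF H a m_closed[OF g int_pow_closed[OF a]]]
      proof safe
        fix h and j :: int assume "h \<in> H"
        then show "\<exists>h'\<in>H. \<exists>j'. h \<otimes> (g \<otimes> a [^] int k) \<otimes> a [^] j = h' \<otimes> g \<otimes> a [^] (j'::int)"
          using eq[of h j] by metis
      next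
        fix h and j :: int assume h: "h \<in> H"
        have "h \<otimes> g \<otimes> a [^] j = h \<otimes> (g \<otimes> a [^] int k) \<otimes> a [^] (j - int k)"
          using eq[OF h, of "j - int k"] by simp
        then show "\<exists>h'\<in>H. \<exists>j'. h \<otimes> g \<otimes> a [^] j = h' \<otimes> (g \<otimes> a [^] int k) \<otimes> a [^] (j'::int)"
          using h by metis
      qed
    qed
    then show "c \<in> ?X" using c a g sub by (auto intro!: rcosetsI)
  next
    fix c assume "c \<in> ?X"
    then obtain x where x: "x \<in> carrier G" "c = H #> x"
      and eq: "c <#> generate G {a} = (H #> g) <#> generate G {a}"
      by (auto simp: RCOSETS_def)
    have "x = \<one> \<otimes> x \<otimes> a [^] (0::int)" using x by simp
    then have "x \<in> c <#> generate G {a}"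
      unfolding x mem_double_coset_iff[OF H a x(1)] using subgroup.one_closed[OF H] by metis
    then obtain h k where hk: "h \<in> H" "x = h \<otimes> g \<otimes> a [^] (k::int)"
      unfolding eq mem_double_coset_iff[OF H a g] by blast
    have "x \<in> H #> (g \<otimes> a [^] k)"
      using hk a g sub by (auto simp: r_coset_def m_assoc subset_iff)
    then have "c = H #> (g \<otimes> a [^] k)"
      unfolding x by (intro repr_independence[symmetric]) (use a g H in auto)
    \<comment> \<open>\<open>k\<close> may be negative or large; its residue names the same coset
      and lies in the listed range.\<close>
    also have "\<dots> = H #> (g \<otimes> a [^] int (nat (k mod int ?d)))"
      unfolding cos using return_time(1)[OF H fin a g] by (simp add: minus_mod_eq_mult_div)
    finally show "c \<in> (\<lambda>k. H #> (g \<otimes> a [^] int k)) ` {..<?d}"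
      using return_time(1)[OF H fin a g]
      by (intro image_eqI[of _ _ "nat (k mod int ?d)"]) (simp_all add: nat_less_iff)
  qed
  from bij_betw_same_card[OF this] show ?thesis by simp
qed

text \<open>The double cosets are the orbits of \<open>\<alpha>\<close> on the right cosets of \<open>H\<close>, and the return time is the
  size of the orbit; weighting by its reciprocal turns the sum over orbits into a sum over cosets.\<close>

lemma frag_eval_pullback_sum:
  assumes H: "subgroup H G" and fin: "finite (rcosets H)" and a: "a \<in> carrier G"
    and \<gamma>: "\<And>s. s \<in> double_cosets G H a \<Longrightarrow> \<gamma> s \<in> s"
    and r: "\<And>c. c \<in> rcosets H \<Longrightarrow> r c \<in> c"
  shows "frag_eval f (pullback_sum G H a \<gamma>)
       = (\<Sum>c\<in>rcosets H. f (loop_class H a (r c)) / return_time G H a (r c))"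
proof -
  have "frag_eval f (pullback_sum G H a \<gamma>)
      = (\<Sum>s\<in>(\<lambda>c. c <#> generate G {a}) ` (rcosets H). f (loop_class H a (\<gamma> s)))"
    unfolding pullback_sum_def frag_eval_sum loop_class_def double_cosets_eq_image by simp
  also have "\<dots> = (\<Sum>c\<in>rcosets H. f (loop_class H a (\<gamma> (c <#> generate G {a})))
      / card {c'\<in>rcosets H. c' <#> generate G {a} = c <#> generate G {a}})"
    by (rule sum_image_weighted[OF fin])
  also have "\<dots> = (\<Sum>c\<in>rcosets H. f (loop_class H a (r c)) / return_time G H a (r c))"
  proof (rule sum.cong[OF refl])
    fix c assume c: "c \<in> rcosets H"
    then obtain x where x: "x \<in> carrier G" "c = H #> x" by (auto simp: RCOSETS_def)
    have rc: "r c \<in> carrier G" "c = H #> r c"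
      using r[OF c] x H subgroup.elemrcos_carrier[OF H is_group x(1)] repr_independence[OF _ x(1) H]
      by auto
    \<comment> \<open>The representative of the double coset need not lie in the coset
      \<open>c\<close> itself. It differs from \<open>r c\<close> by a left factor in
      \<open>H\<close> and a power of \<open>a\<close>, which \<open>loop_translate\<close>
      ignores.\<close>
    have "\<gamma> (c <#> generate G {a}) \<in> (H #> r c) <#> generate G {a}"
      using \<gamma> c rc(2) unfolding double_cosets_eq_image by auto
    then obtain h k where hk: "h \<in> H" "\<gamma> (c <#> generate G {a}) = h \<otimes> r c \<otimes> a [^] (k::int)"
      unfolding mem_double_coset_iff[OF H a rc(1)] by blast
    show "f (loop_class H a (\<gamma> (c <#> generate G {a})))
      / card {c'\<in>rcosets H. c' <#> generate G {a} = c <#> generate G {a}}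
      = f (loop_class H a (r c)) / return_time G H a (r c)"
      using card_orbit_coset[OF H fin a rc(1)] rc(2) loop_translate(2)[OF H fin a rc(1) hk(1)] hk(2) by simp
  qed
  finally show ?thesis .
qed

lemma finite_double_cosets: "finite (rcosets H) \<Longrightarrow> finite (double_cosets G H a)"
  by (simp add: double_cosets_eq_image)

text \<open>Right translation by \<open>h\<close> permutes the cosets, and the loop of h a h^-1 at x
  h^-1 is the loop of \<open>a\<close> at x. Both systems of representatives are arbitrary, so the
  lemma disposes of the choice in the class and of the choice in the double cosets together.\<close>

lemma pullback_sum_conj:
  assumes H: "subgroup H G" and fin: "finite (rcosets H)" and a: "a \<in> carrier G" and h: "h \<in> carrier G"
    and \<gamma>: "\<And>s. s \<in> double_cosets G H a \<Longrightarrow> \<gamma> s \<in> s"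
    and \<gamma>': "\<And>s. s \<in> double_cosets G H (h \<otimes> a \<otimes> inv h) \<Longrightarrow> \<gamma>' s \<in> s"
  shows "pullback_sum G H (h \<otimes> a \<otimes> inv h) \<gamma>' = pullback_sum G H a \<gamma>"
proof (rule frag_eqI)
  fix f
  define a' where "a' = h \<otimes> a \<otimes> inv h"
  have a': "a' \<in> carrier G" using a h by (simp add: a'_def)
  have sub: "H \<subseteq> carrier G" using H by (rule subgroup.subset)
  have shift: "(H #> x) #> y = H #> (x \<otimes> y)" if "x \<in> carrier G" "y \<in> carrier G" for x y
    using that by (simp add: coset_mult_assoc sub)
  define r where "r c = (SOME x. x \<in> c)" for c :: "'a set"
  have r: "r c \<in> c" "r c \<in> carrier G" "c = H #> r c" if c: "c \<in> rcosets H" for c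
  proof -
    obtain x where x: "x \<in> carrier G" "c = H #> x" using c by (auto simp: RCOSETS_def)
    have "x \<in> c" using x H by (simp add: rcos_self)
    then show "r c \<in> c" unfolding r_def by (rule someI)
    then show "r c \<in> carrier G" "c = H #> r c"
      using x H subgroup.elemrcos_carrier[OF H is_group x(1)] repr_independence[OF _ x(1) H] by auto
  qed
  have shift_mem: "c #> y \<in> rcosets H" if "c \<in> rcosets H" "y \<in> carrier G" for c y
    using that sub by (auto simp: RCOSETS_def shift)
  \<comment> \<open>A representative of \<open>c\<close> adapted to the conjugated element: the one
    of the translated coset, moved back by h^-1. With it the two sums match term by term.\<close>
  have r': "r (c #> h) \<otimes> inv h \<in> c" if c: "c \<in> rcosets H" for c
  proof -
    obtain x where x: "x \<in> carrier G" "c = H #> x" using c by (auto simp: RCOSETS_def)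
    have "r (c #> h) \<otimes> inv h \<in> (c #> h) #> inv h"
      using r(1)[OF shift_mem[OF c h]] by (auto simp: r_coset_def)
    also have "(c #> h) #> inv h = c" using x h by (simp add: shift m_assoc)
    finally show ?thesis .
  qed
  have eq: "(x \<otimes> inv h) \<otimes> a' [^] (n::nat) \<otimes> inv (x \<otimes> inv h) = x \<otimes> a [^] n \<otimes> inv x"
    if x: "x \<in> carrier G" for x n
  proof -
    have "inv h \<otimes> a' [^] n \<otimes> inv (inv h) = a [^] n"
      using a h conj_conj[of "a [^] n" h "inv h"] by (simp add: a'_def conj_nat_pow)
    then show ?thesis
      using conj_conj[of "a' [^] n" "inv h" x] x h a' by simp
  qed
  have rt: "return_time G H a' (x \<otimes> inv h) = return_time G H a x" if "x \<in> carrier G" for x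
    unfolding return_time_def eq[OF that] ..
  have lc: "loop_class H a' (x \<otimes> inv h) = loop_class H a x" if "x \<in> carrier G" for x
    unfolding loop_class_def rt[OF that] eq[OF that] ..
  have "frag_eval f (pullback_sum G H a' \<gamma>')
      = (\<Sum>c\<in>rcosets H. f (loop_class H a' (r (c #> h) \<otimes> inv h)) / return_time G H a' (r (c #> h) \<otimes> inv h))"
    by (rule frag_eval_pullback_sum[OF H fin a' _ r']) (use \<gamma>' in \<open>auto simp: a'_def\<close>)
  also have "\<dots> = (\<Sum>c\<in>rcosets H. f (loop_class H a (r c)) / return_time G H a (r c))"
  proof (rule sum.reindex_bij_witness[of _ "\<lambda>c. c #> inv h" "\<lambda>c. c #> h"])
    fix c assume c: "c \<in> rcosets H"
    show "c #> h \<in> rcosets H" "c #> inv h \<in> rcosets H" using shift_mem c h by auto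
    show "(c #> h) #> inv h = c" "(c #> inv h) #> h = c"
      using r(2)[OF c] h by (subst (1 2) r(3)[OF c], simp add: shift m_assoc)+
    show "f (loop_class H a (r (c #> h))) / return_time G H a (r (c #> h)) =
      f (loop_class H a' (r (c #> h) \<otimes> inv h)) / return_time G H a' (r (c #> h) \<otimes> inv h)"
      using r(2)[OF shift_mem[OF c h]] by (simp add: rt lc)
  qed
  also have "\<dots> = frag_eval f (pullback_sum G H a \<gamma>)"
    by (rule frag_eval_pullback_sum[OF H fin a \<gamma> r(1), symmetric])
  finally show "frag_eval f (pullback_sum G H (h \<otimes> a \<otimes> inv h) \<gamma>') = frag_eval f (pullback_sum G H a \<gamma>)"
    by (simp add: a'_def)
qed

lemma double_coset_nonempty:
  assumes "subgroup H G" "a \<in> carrier G" "s \<in> double_cosets G H a"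
  shows "s \<noteq> {}"
proof -
  obtain g where g: "g \<in> carrier G" "s = (H #> g) <#> generate G {a}"
    using assms by (auto simp: double_cosets_def)
  show ?thesis
    using mem_double_coset_iff[OF assms(1,2) g(1)] subgroup.one_closed[OF assms(1)] g(2) by blast
qed

text \<open>The element that \<open>pullback\<close> selects from the class is some conjugate of
  \<open>a\<close>, so \<open>pullback_sum_conj\<close> compares it with \<open>a\<close>; the
  selected representatives are genuine because double cosets are nonempty.\<close>

lemma pullback_frag_of:
  assumes H: "subgroup H G" and fin: "finite (rcosets H)" and a: "a \<in> carrier G"
    and \<gamma>: "\<And>s. s \<in> double_cosets G H a \<Longrightarrow> \<gamma> s \<in> s"
  shows "pullback G H (frag_of (conj_class G a)) = pullback_sum G H a \<gamma>"
proof -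
  have "(SOME x. x \<in> conj_class G a) \<in> conj_class G a"
    using conj_class_self[OF a] by (rule someI)
  then obtain h where h: "h \<in> carrier G" "(SOME x. x \<in> conj_class G a) = h \<otimes> a \<otimes> inv h"
    by (auto simp: conj_class_def)
  then show ?thesis
    unfolding pullback_def frag_extend_of
    using pullback_sum_conj[OF H fin a h(1) \<gamma>, of "\<lambda>s. SOME \<gamma>. \<gamma> \<in> s"]
      double_coset_nonempty[OF H, of "h \<otimes> a \<otimes> inv h"] a
    by (simp add: some_in_eq)
qed

lemma frag_eval_pullback:
  assumes H: "subgroup H G" and fin: "finite (rcosets H)" and a: "a \<in> carrier G"
    and r: "\<And>c. c \<in> rcosets H \<Longrightarrow> r c \<in> c"
  shows "frag_eval f (pullback G H (frag_of (conj_class G a)))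
       = (\<Sum>c\<in>rcosets H. f (loop_class H a (r c)) / return_time G H a (r c))"
proof -
  have "(SOME \<gamma>. \<gamma> \<in> s) \<in> s" if "s \<in> double_cosets G H a" for s
    using double_coset_nonempty[OF H a that] by (simp add: some_in_eq)
  then show ?thesis
    using frag_eval_pullback_sum[OF H fin a _ r, of "\<lambda>s. SOME \<gamma>. \<gamma> \<in> s" f]
      pullback_frag_of[OF H fin a, of "\<lambda>s. SOME \<gamma>. \<gamma> \<in> s"] by simp
qed

end

section \<open>Pullbacks and induced maps as homomorphisms of free abelian groups\<close>

lemma frag_extend_in_hom_Zlambda:
  assumes "\<And>C. C \<in> conj_classes G \<Longrightarrow> b C \<in> carrier (Zlambda G')"
  shows "frag_extend b \<in> hom (Zlambda G) (Zlambda G')"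
proof (rule homI)
  fix z assume "z \<in> carrier (Zlambda G)"
  then show "frag_extend b z \<in> carrier (Zlambda G')"
    using assms keys_frag_extend[of b z] unfolding Zlambda_def by fastforce
qed (simp add: Zlambda_def frag_extend_add)

lemma (in group) pullback_in_hom:
  assumes H: "subgroup H G" and fin: "finite (rcosets H)"
  shows "pullback G H \<in> hom (Zlambda G) (Zlambda (G\<lparr>carrier := H\<rparr>))"
proof -
  have "pullback_sum G H (SOME a. a \<in> C) (\<lambda>s. SOME \<gamma>. \<gamma> \<in> s) \<in> carrier (Zlambda (G\<lparr>carrier := H\<rparr>))"
    if C: "C \<in> conj_classes G" for C
  proof -
    obtain x where x: "x \<in> carrier G" "C = conj_class G x" using C by (auto simp: conj_classes_def)
    define a where "a = (SOME a. a \<in> C)"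
    have "a \<in> C" unfolding a_def x using conj_class_self[OF x(1)] by (rule someI)
    then have a: "a \<in> carrier G" using x by (auto simp: conj_class_def)
    have "(SOME \<gamma>. \<gamma> \<in> s) \<in> carrier G" if s: "s \<in> double_cosets G H a" for s
    proof -
      have "(SOME \<gamma>. \<gamma> \<in> s) \<in> s" using double_coset_nonempty[OF H a s] by (simp add: some_in_eq)
      moreover obtain g where g: "g \<in> carrier G" "s = (H #> g) <#> generate G {a}"
        using s by (auto simp: double_cosets_def)
      ultimately show ?thesis
        using mem_double_coset_iff[OF H a g(1)] a g subgroup.mem_carrier[OF H] by auto
    qed
    then have "frag_of (conj_class (G\<lparr>carrier := H\<rparr>) (g s \<otimes> a [^] return_time G H a (g s) \<otimes> inv (g s)))
        \<in> carrier (Zlambda (G\<lparr>carrier := H\<rparr>))"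
      if "s \<in> double_cosets G H a" "g = (\<lambda>s. SOME \<gamma>. \<gamma> \<in> s)" for s g
      using that loop_mem[OF H fin a] by (simp add: Zlambda_def conj_classes_def)
    then show ?thesis
      unfolding pullback_sum_def Zlambda_def a_def[symmetric] by (intro sum_closed_free_Abelian_group) auto
  qed
  then show ?thesis
    unfolding pullback_def by (intro frag_extend_in_hom_Zlambda)
qed

lemma induced_map_in_hom:
  assumes "group G" "group G'" "\<psi> \<in> hom G G'"
  shows "induced_map G G' \<psi> \<in> hom (Zlambda G) (Zlambda G')"
proof -
  have "frag_of (THE D. D \<in> conj_classes G' \<and> \<psi> ` C \<subseteq> D) \<in> carrier (Zlambda G')"
    if C: "C \<in> conj_classes G" for C
  proof -
    obtain x where x: "x \<in> carrier G" "C = conj_class G x" using C by (auto simp: conj_classes_def)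
    have "frag_of (THE D. D \<in> conj_classes G' \<and> \<psi> ` C \<subseteq> D) = frag_of (conj_class G' (\<psi> x))"
      using induced_map_frag_of[OF assms x(1)] x(2) by (simp add: induced_map_def)
    then show ?thesis
      using hom_in_carrier[OF assms(3) x(1)] by (auto simp: Zlambda_def conj_classes_def)
  qed
  then show ?thesis
    unfolding induced_map_def by (rule frag_extend_in_hom_Zlambda)
qed

section \<open>Lattices in the plane\<close>

text \<open>The adjugate, an inverse up to the scalar det A. It allows cancellation of A, and shows
  that det A times any vector lies in the row lattice, without fractions.\<close>

definition adj2 :: "int^2^2 \<Rightarrow> int^2^2" where
  "adj2 A = vector [vector [A$2$2, - (A$1$2)], vector [- (A$2$1), A$1$1]]"

definition lat :: "int^2^2 \<Rightarrow> (int^2) set" where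
  "lat A = range (\<lambda>v. v v* A)"

lemma adj2_mult: "A ** adj2 A = mat (det A)" "adj2 A ** A = mat (det A)"
  by (simp_all add: adj2_def det_2 matrix_matrix_mult_def mat_def vec_eq_iff forall_2 sum_2 algebra_simps)

lemma vector_mult_mat: "v v* (mat d :: int^2^2) = d *s v"
  by (simp add: vector_matrix_mult_def mat_def vec_eq_iff forall_2 sum_2)

lemma vector_mult_cancel:
  fixes A :: "int^2^2"
  assumes "det A \<noteq> 0" "v v* A = w v* A"
  shows "v = w"
proof -
  have "(v v* A) v* adj2 A = (w v* A) v* adj2 A" using assms by simp
  then show ?thesis
    using assms(1) by (simp add: vector_matrix_mul_assoc adj2_mult vector_mult_mat vec_eq_iff)
qed

lemma row_eq_axis_mult: "axis i 1 v* B = (B $ i :: int^2)"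
  by (simp add: vector_matrix_mult_def axis_def vec_eq_iff if_distrib if_distribR cong: if_cong)

lemma matrix_mult_row: "(U ** A) $ i = (U $ i) v* (A :: int^2^2)"
  by (simp add: matrix_matrix_mult_def vector_matrix_mult_def vec_eq_iff mult.commute)

lemma matrix_mult_right_cancel:
  fixes A :: "int^2^2"
  assumes "det A \<noteq> 0" "B ** A = C ** A"
  shows "B = C"
proof -
  have "B $ i = C $ i" for i
    using vector_mult_cancel[OF assms(1), of "B $ i" "C $ i"] assms(2) by (simp flip: matrix_mult_row)
  then show ?thesis by (simp add: vec_eq_iff)
qed

lemma row_mem_lat: "A $ i \<in> lat A"
  unfolding lat_def using row_eq_axis_mult[of i A] by (metis rangeI)

text \<open>Every row of \<open>C\<close> is an integral combination of the rows of
  \<open>A\<close>; the coefficient vectors are the rows of \<open>U\<close>.\<close>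

lemma lat_subset_imp_factor:
  assumes "lat C \<subseteq> lat A"
  obtains U where "C = U ** A"
proof -
  have "\<forall>i. \<exists>u. C $ i = u v* A"
    using assms row_mem_lat[of C] unfolding lat_def by blast
  then obtain u where u: "C $ i = u i v* A" for i by metis
  have "C = (\<chi> i. u i) ** A"
    by (subst vec_eq_iff) (simp add: matrix_mult_row u)
  then show ?thesis by (rule that)
qed

lemma lattice_act_lat: "lattice_act (lat A) B = lat (A ** B)"
  unfolding lattice_act_def lat_def by (simp add: image_image vector_matrix_mul_assoc)

lemma lattice_act_act: "lattice_act (lattice_act L A) B = lattice_act L (A ** B)"
  unfolding lattice_act_def by (simp add: image_image vector_matrix_mul_assoc)

lemma lattice_act_one: "lattice_act L (mat 1) = L"
  unfolding lattice_act_def by simp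

lemma det_mult_mem_lat: "det A *s v \<in> lat A"
proof -
  have "det A *s v = (v v* adj2 A) v* A"
    by (simp add: vector_matrix_mul_assoc adj2_mult vector_mult_mat)
  then show ?thesis unfolding lat_def by blast
qed

lemma is_lattice_matrix_iff: "is_lattice_matrix N L A \<longleftrightarrow> det A = int N \<and> L = lat A"
  by (simp add: is_lattice_matrix_def lat_def)

section \<open>Sublattices of finite index\<close>

lemma Z2_simps [simp]: "carrier Z2 = UNIV" "x \<otimes>\<^bsub>Z2\<^esub> y = x + y" "\<one>\<^bsub>Z2\<^esub> = 0"
  by (simp_all add: Z2_def)

lemma group_Z2: "group Z2"
proof (rule groupI)
  show "\<exists>y\<in>carrier Z2. y \<otimes>\<^bsub>Z2\<^esub> x = \<one>\<^bsub>Z2\<^esub>" for x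
    by (auto intro: exI[of _ "- x"])
qed (auto simp: add.assoc)

interpretation Z2: group Z2 by (rule group_Z2)

lemma inv_Z2 [simp]: "inv\<^bsub>Z2\<^esub> x = - x"
  by (rule Z2.inv_equality) auto

lemma subgroup_Z2_iff: "subgroup L Z2 \<longleftrightarrow> 0 \<in> L \<and> (\<forall>x\<in>L. \<forall>y\<in>L. x - y \<in> L)"
proof
  assume L: "subgroup L Z2"
  have "x - y \<in> L" if "x \<in> L" "y \<in> L" for x y
    using subgroup.m_closed[OF L that(1) subgroup.m_inv_closed[OF L that(2)]] by simp
  then show "0 \<in> L \<and> (\<forall>x\<in>L. \<forall>y\<in>L. x - y \<in> L)"
    using subgroup.one_closed[OF L] by simp
next
  assume *: "0 \<in> L \<and> (\<forall>x\<in>L. \<forall>y\<in>L. x - y \<in> L)"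
  then have minus: "- x \<in> L" if "x \<in> L" for x
    using that by (metis diff_0)
  have "x + y \<in> L" if "x \<in> L" "y \<in> L" for x y
    using * that(1) minus[OF that(2)] by (metis diff_minus_eq_add)
  then show "subgroup L Z2"
    using * minus by (intro Z2.subgroupI) auto
qed

lemma subgroup_lat: "subgroup (lat A) Z2"
  unfolding subgroup_Z2_iff lat_def
  by (auto simp flip: vector_matrix_mult_diff_distrib intro: range_eqI[of _ _ 0])

text \<open>Translates the multiplicative notation of abstract groups, so that the results on return
  times apply to the additive group of the plane.\<close>

lemma int_pow_Z2: "x [^]\<^bsub>Z2\<^esub> (k::int) = k *s x"
proof -
  have nat: "x [^]\<^bsub>Z2\<^esub> (n::nat) = int n *s x" for n
    by (induction n) (auto simp: vec_eq_iff algebra_simps)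
  show ?thesis
    by (cases k rule: int_cases2) (simp_all add: nat int_pow_int Z2.int_pow_neg_int vec_eq_iff)
qed

lemma subgroup_Z2_scale: "subgroup L Z2 \<Longrightarrow> v \<in> L \<Longrightarrow> k *s v \<in> L"
  using Z2.subgroup_int_pow_closed[of L v k] by (simp add: int_pow_Z2)

lemma subgroup_Z2_diff: "subgroup L Z2 \<Longrightarrow> v \<in> L \<Longrightarrow> w \<in> L \<Longrightarrow> v - w \<in> L"
  by (simp add: subgroup_Z2_iff)

lemma subgroup_Z2_add: "subgroup L Z2 \<Longrightarrow> v \<in> L \<Longrightarrow> w \<in> L \<Longrightarrow> v + w \<in> L"
  using subgroup.m_closed[of L Z2 v w] by simp

lemma coset_Z2_eq_iff:
  assumes L: "subgroup L Z2"
  shows "L #>\<^bsub>Z2\<^esub> v = L #>\<^bsub>Z2\<^esub> w \<longleftrightarrow> v - w \<in> L"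
proof -
  have mem: "x \<in> L #>\<^bsub>Z2\<^esub> y \<longleftrightarrow> x - y \<in> L" for x y
    unfolding r_coset_def by (auto intro: bexI[of _ "x - y"])
  show ?thesis
  proof
    assume "L #>\<^bsub>Z2\<^esub> v = L #>\<^bsub>Z2\<^esub> w"
    then show "v - w \<in> L"
      using Z2.rcos_self[OF _ L, of v] mem by simp
  next
    assume "v - w \<in> L"
    then show "L #>\<^bsub>Z2\<^esub> v = L #>\<^bsub>Z2\<^esub> w"
      using Z2.repr_independence[OF _ _ L, of v w] mem by simp
  qed
qed

section \<open>Hermite normal form and the index of a plane lattice\<close>

lemma least_positive_generator:
  fixes K :: "int set"
  assumes diff: "\<And>x y. x \<in> K \<Longrightarrow> y \<in> K \<Longrightarrow> x - y \<in> K" and m: "m \<in> K" "m > 0"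
  obtains d where "d \<in> K" "d > 0" "\<And>x. x \<in> K \<Longrightarrow> d dvd x"
proof -
  define n where "n = (LEAST n. 0 < n \<and> int n \<in> K)"
  have "0 < nat m \<and> int (nat m) \<in> K" using m by simp
  then have n: "0 < n" "int n \<in> K"
    unfolding n_def by (rule LeastI2; blast)+
  have zero: "0 \<in> K" using diff[OF m(1) m(1)] by simp
  have neg: "- x \<in> K" if "x \<in> K" for x using diff[OF zero that] by simp
  have add: "x + y \<in> K" if "x \<in> K" "y \<in> K" for x y using diff[OF that(1) neg[OF that(2)]] by simp
  have nat_mult: "int k * int n \<in> K" for k
    by (induction k) (auto simp: zero add n algebra_simps)
  have mult: "q * int n \<in> K" for q
    using nat_mult[of "nat q"] neg[OF nat_mult[of "nat (- q)"]] by (cases "q \<ge> 0") auto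
  have "int n dvd x" if x: "x \<in> K" for x
  proof -
    have "int (nat (x mod int n)) = x mod int n" using n by simp
    also have "x mod int n = x - (x div int n) * int n" by (simp add: minus_div_mult_eq_mod)
    also have "\<dots> \<in> K" using diff x mult by blast
    finally have "int (nat (x mod int n)) \<in> K" .
    moreover have "nat (x mod int n) < n" using n by (simp add: nat_less_iff)
    ultimately have "\<not> 0 < nat (x mod int n)"
      using not_less_Least[of "nat (x mod int n)" "\<lambda>n. 0 < n \<and> int n \<in> K"] by (simp only: n_def[symmetric]) simp
    then show ?thesis
      using n pos_mod_sign[of "int n" x] unfolding dvd_eq_mod_eq_0 by linarith
  qed
  then show ?thesis using that[of "int n"] n by simp
qed

text \<open>Hermite normal form: an upper triangular row basis. With 0 \<le> b < d only finitely
  many of them have a given positive determinant.\<close>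

definition hnf :: "int \<Rightarrow> int \<Rightarrow> int \<Rightarrow> int^2^2" where
  "hnf a b d = vector [vector [a, b], vector [0, d]]"

lemma det_hnf: "det (hnf a b d) = a * d"
  by (simp add: hnf_def det_2)

lemma vec2_eq_iff: "(v :: 'a^2) = w \<longleftrightarrow> v$1 = w$1 \<and> v$2 = w$2"
  by (simp add: vec_eq_iff forall_2)

lemma mem_lat_hnf_iff:
  "v \<in> lat (hnf a b d) \<longleftrightarrow> (\<exists>x y. v$1 = x * a \<and> v$2 = x * b + y * d)"
proof
  assume "v \<in> lat (hnf a b d)"
  then obtain u where "v = u v* hnf a b d" by (auto simp: lat_def)
  then show "\<exists>x y. v$1 = x * a \<and> v$2 = x * b + y * d"
    by (intro exI[of _ "u$1"] exI[of _ "u$2"]) (simp add: hnf_def vector_matrix_mult_def sum_2 mult.commute)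
next
  assume "\<exists>x y. v$1 = x * a \<and> v$2 = x * b + y * d"
  then obtain x y where xy: "v$1 = x * a" "v$2 = x * b + y * d" by blast
  have "v = vector [x, y] v* hnf a b d"
    unfolding vec2_eq_iff by (simp add: hnf_def vector_matrix_mult_def sum_2 mult.commute xy)
  then show "v \<in> lat (hnf a b d)" unfolding lat_def by blast
qed

text \<open>The first coordinates of \<open>L\<close> form a subgroup generated by \<open>a\<close>,
  and the second coordinates of the vectors of \<open>L\<close> on the axis v$1 = 0 form one
  generated by \<open>d\<close>. A lift of \<open>a\<close> and a generator on the axis span
  \<open>L\<close>. The assumption on multiples expresses full rank and makes both subgroups
  nonzero.\<close>

lemma subgroup_Z2_hnf:
  assumes L: "subgroup L Z2" and fin: "\<And>v. \<exists>k>0. k *s v \<in> L"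
  obtains a b d where "0 < a" "0 < d" "0 \<le> b" "b < d" "L = lat (hnf a b d)"
proof -
  define K1 where "K1 = {v$1 | v. v \<in> L}"
  define K2 where "K2 = {v$2 | v. v \<in> L \<and> v$1 = 0}"
  have K2I: "v$2 \<in> K2" if "v \<in> L" "v$1 = 0" for v
    using that by (auto simp: K2_def)
  have K1I: "v$1 \<in> K1" if "v \<in> L" for v
    using that by (auto simp: K1_def)
  obtain k1 where k1: "k1 > 0" "k1 *s vector [1, 0] \<in> L" using fin by blast
  obtain k2 where k2: "k2 > 0" "k2 *s vector [0, 1] \<in> L" using fin by blast
  have K1diff: "x - y \<in> K1" if xy: "x \<in> K1" "y \<in> K1" for x y
  proof -
    obtain v w where "v \<in> L" "w \<in> L" "x = v$1" "y = w$1" using xy by (auto simp: K1_def)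
    then show ?thesis using K1I[OF subgroup_Z2_diff[OF L], of v w] by simp
  qed
  have K2diff: "x - y \<in> K2" if xy: "x \<in> K2" "y \<in> K2" for x y
  proof -
    obtain v w where "v \<in> L" "w \<in> L" "x = v$2" "y = w$2" "v$1 = 0" "w$1 = 0"
      using xy by (auto simp: K2_def)
    then show ?thesis using K2I[OF subgroup_Z2_diff[OF L], of v w] by simp
  qed
  have "k1 \<in> K1" using K1I[OF k1(2)] by simp
  then obtain a where a: "a \<in> K1" "a > 0" "\<And>x. x \<in> K1 \<Longrightarrow> a dvd x"
    using least_positive_generator[OF K1diff] k1(1) by blast
  have "k2 \<in> K2" using K2I[OF k2(2)] by simp
  then obtain d where d: "d \<in> K2" "d > 0" "\<And>x. x \<in> K2 \<Longrightarrow> d dvd x"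
    using least_positive_generator[OF K2diff] k2(1) by blast
  obtain u where u: "u \<in> L" "u$1 = a" using a(1) by (auto simp: K1_def)
  obtain w where w: "w \<in> L" "w$1 = 0" "w$2 = d" using d(1) by (auto simp: K2_def)
  define b where "b = u$2 mod d"
  have b: "0 \<le> b" "b < d" using d(2) by (simp_all add: b_def)
  \<comment> \<open>Subtracting a multiple of the axis vector \<open>w\<close> brings the second
    entry of the lift into the range from 0 to d - 1.\<close>
  define u' where "u' = u - (u$2 div d) *s w"
  have u': "u' \<in> L" "u'$1 = a" "u'$2 = b"
    using u w subgroup_Z2_diff[OF L u(1) subgroup_Z2_scale[OF L w(1)]]
    by (simp_all add: u'_def b_def minus_div_mult_eq_mod)
  have "v \<in> L \<longleftrightarrow> (\<exists>x y. v$1 = x * a \<and> v$2 = x * b + y * d)" for v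
  proof
    assume v: "v \<in> L"
    obtain x where x: "v$1 = x * a" using a(3)[OF K1I[OF v]] by (metis dvdE mult.commute)
    define v' where "v' = v - x *s u'"
    have "v' \<in> L" unfolding v'_def using subgroup_Z2_diff[OF L v subgroup_Z2_scale[OF L u'(1)]] .
    moreover have "v'$1 = 0" "v'$2 = v$2 - x * b" by (simp_all add: v'_def x u')
    ultimately obtain y where "v$2 - x * b = y * d"
      using d(3)[OF K2I, of v'] by (metis dvdE mult.commute)
    then show "\<exists>x y. v$1 = x * a \<and> v$2 = x * b + y * d"
      using x by (metis add.commute diff_add_cancel)
  next
    assume "\<exists>x y. v$1 = x * a \<and> v$2 = x * b + y * d"
    then obtain x y where "v = x *s u' + y *s w"
      unfolding vec2_eq_iff by (auto simp: u' w)
    then show "v \<in> L"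
      using subgroup_Z2_add[OF L] subgroup_Z2_scale[OF L] u'(1) w(1) by simp
  qed
  then have "L = lat (hnf a b d)" using mem_lat_hnf_iff by blast
  then show ?thesis using that a(2) d(2) b by blast
qed

text \<open>The box with sides \<open>a\<close> and \<open>d\<close> is a fundamental domain: the
  first row reduces the first coordinate modulo \<open>a\<close>, then the second row reduces the
  second modulo \<open>d\<close>.\<close>

lemma card_rcosets_hnf:
  assumes a: "0 < a" and d: "0 < d"
  shows "card (rcosets\<^bsub>Z2\<^esub> (lat (hnf a b d))) = nat (a * d)"
proof -
  let ?L = "lat (hnf a b d)"
  note eq = coset_Z2_eq_iff[OF subgroup_lat[of "hnf a b d"]]
  have "bij_betw (\<lambda>(i, j). ?L #>\<^bsub>Z2\<^esub> vector [i, j]) ({0..<a} \<times> {0..<d}) (rcosets\<^bsub>Z2\<^esub> ?L)"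
    unfolding bij_betw_def
  proof (intro conjI inj_onI equalityI subsetI)
    fix p q assume pq: "p \<in> {0..<a} \<times> {0..<d}" "q \<in> {0..<a} \<times> {0..<d}"
      "(case p of (i, j) \<Rightarrow> ?L #>\<^bsub>Z2\<^esub> vector [i, j]) = (case q of (i, j) \<Rightarrow> ?L #>\<^bsub>Z2\<^esub> vector [i, j])"
    obtain i j i' j' where p: "p = (i, j)" "q = (i', j')" by fastforce
    have "vector [i, j] - vector [i', j'] \<in> ?L" using pq eq p by simp
    then obtain x y where xy: "i - i' = x * a" "j - j' = x * b + y * d"
      unfolding mem_lat_hnf_iff by auto
    have "i mod a = i' mod a" using xy(1) by (simp add: mod_eq_dvd_iff)
    then have "i = i'" using pq p by simp
    then have "x = 0" using xy(1) a by simp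
    then have "j mod d = j' mod d" using xy(2) by (simp add: mod_eq_dvd_iff)
    then have "j = j'" using pq p by simp
    then show "p = q" using \<open>i = i'\<close> p by simp
  next
    fix c assume "c \<in> (\<lambda>(i, j). ?L #>\<^bsub>Z2\<^esub> vector [i, j]) ` ({0..<a} \<times> {0..<d})"
    then show "c \<in> rcosets\<^bsub>Z2\<^esub> ?L" by (auto simp: RCOSETS_def)
  next
    fix c assume "c \<in> rcosets\<^bsub>Z2\<^esub> ?L"
    then obtain v where v: "c = ?L #>\<^bsub>Z2\<^esub> v" by (auto simp: RCOSETS_def)
    define i where "i = v$1 mod a"
    \<comment> \<open>Reducing the first coordinate has already changed the second by the same
      multiple of \<open>b\<close>.\<close>
    define j where "j = (v$2 - (v$1 div a) * b) mod d"
    have "v - vector [i, j] \<in> ?L"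
      unfolding mem_lat_hnf_iff
      by (intro exI[of _ "v$1 div a"] exI[of _ "(v$2 - (v$1 div a) * b) div d"])
        (simp add: i_def j_def minus_mod_eq_div_mult algebra_simps)
    then have "c = ?L #>\<^bsub>Z2\<^esub> vector [i, j]" using v eq by simp
    moreover have "(i, j) \<in> {0..<a} \<times> {0..<d}" using a d by (simp add: i_def j_def)
    ultimately show "c \<in> (\<lambda>(i, j). ?L #>\<^bsub>Z2\<^esub> vector [i, j]) ` ({0..<a} \<times> {0..<d})"
      by force
  qed
  from bij_betw_same_card[OF this] show ?thesis
    using a d by (simp add: nat_mult_distrib card_cartesian_product)
qed

lemma sublatticeD:
  assumes "L \<in> sublattices N" "N \<ge> 1"
  obtains a b d where "0 < a" "0 < d" "0 \<le> b" "b < d" "L = lat (hnf a b d)" "a * d = int N"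
proof -
  have L: "subgroup L Z2" and card: "card (rcosets\<^bsub>Z2\<^esub> L) = N"
    using assms by (auto simp: sublattices_def)
  \<comment> \<open>An infinite set has \<open>card\<close> 0, so a positive index implies
    finiteness.\<close>
  have fin: "finite (rcosets\<^bsub>Z2\<^esub> L)" using card assms(2) by (metis card.infinite not_one_le_zero)
  have "\<exists>k>0. k *s v \<in> L" for v
  proof (intro exI conjI)
    \<comment> \<open>The return time of \<open>v\<close> at 0 is the order of \<open>v\<close>
      modulo \<open>L\<close>, hence a positive multiple of \<open>v\<close> lies in
      \<open>L\<close>.\<close>
    have "v [^]\<^bsub>Z2\<^esub> int (return_time Z2 L v 0) \<in> L"
      using Z2.return_time(2)[OF L fin, of v 0 "int (return_time Z2 L v 0)"] by simp
    then show "int (return_time Z2 L v 0) *s v \<in> L" by (simp only: int_pow_Z2)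
    show "0 < int (return_time Z2 L v 0)" using Z2.return_time(1)[OF L fin, of v 0] by simp
  qed
  from subgroup_Z2_hnf[OF L this] obtain a b d
    where abd: "0 < a" "0 < d" "0 \<le> b" "b < d" "L = lat (hnf a b d)" by metis
  have "nat (a * d) = N" using card_rcosets_hnf[OF abd(1,2)] card abd(5) by simp
  then have "a * d = int N" using assms(2) by simp
  then show ?thesis using that abd by blast
qed

section \<open>Matrices of sublattices: existence, uniqueness, finiteness\<close>

lemma sublattice_matrix_exists:
  assumes "L \<in> sublattices N" "N \<ge> 1"
  shows "\<exists>A. is_lattice_matrix N L A"
  using sublatticeD[OF assms] by (metis is_lattice_matrix_iff det_hnf)

text \<open>\<open>A\<close> and the normal form of its row lattice are integral left multiples of
  each other, so their determinants divide one another; both are positive, hence equal, and the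
  index is read off the normal form.\<close>

lemma lat_mem_sublattices:
  assumes "det A > 0"
  shows "lat A \<in> sublattices (nat (det A))"
proof -
  have "\<exists>k>0. k *s v \<in> lat A" for v
    using det_mult_mem_lat assms by blast
  from subgroup_Z2_hnf[OF subgroup_lat this] obtain a b d
    where abd: "0 < a" "0 < d" "lat A = lat (hnf a b d)" by metis
  obtain U where U: "A = U ** hnf a b d" using lat_subset_imp_factor abd(3) by blast
  obtain V where V: "hnf a b d = V ** A" using lat_subset_imp_factor abd(3) by blast
  have "det A = det U * (a * d)" "a * d = det V * det A"
    using arg_cong[OF U, of det] arg_cong[OF V, of det] by (simp_all add: det_mul det_hnf)
  then have "det A dvd a * d" "a * d dvd det A"
    by (metis dvd_triv_right)+
  then have "det A = a * d" using assms abd by (simp add: zdvd_antisym_nonneg)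
  then show ?thesis
    using card_rcosets_hnf[OF abd(1,2)] subgroup_lat abd(3) by (simp add: sublattices_def)
qed

lemma is_lattice_matrixD: "is_lattice_matrix N L A \<Longrightarrow> N \<ge> 1 \<Longrightarrow> L \<in> sublattices N"
  using lat_mem_sublattices[of A] by (simp add: is_lattice_matrix_iff)

lemma finite_sublattices:
  assumes "N \<ge> 1"
  shows "finite (sublattices N)"
proof -
  have "sublattices N \<subseteq> (\<lambda>(a, b, d). lat (hnf a b d)) ` ({0..int N} \<times> {0..int N} \<times> {0..int N})"
  proof
    fix L assume "L \<in> sublattices N"
    from sublatticeD[OF this assms] obtain a b d
      where abd: "0 < a" "0 < d" "0 \<le> b" "b < d" "L = lat (hnf a b d)" "a * d = int N" by metis
    have "a \<le> int N" "d \<le> int N"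
      using abd by (metis dvd_triv_left dvd_triv_right zdvd_imp_le zmult_zless_mono2 mult_zero_right)+
    then show "L \<in> (\<lambda>(a, b, d). lat (hnf a b d)) ` ({0..int N} \<times> {0..int N} \<times> {0..int N})"
      using abd by (intro image_eqI[of _ _ "(a, b, d)"]) auto
  qed
  then show ?thesis by (rule finite_subset) auto
qed

text \<open>The change of basis has determinant 1 because both determinants are the same nonzero
  number. This is why the class of A g A^-1 does not depend on \<open>A\<close>.\<close>

lemma is_lattice_matrix_unique:
  assumes "is_lattice_matrix N L A" "is_lattice_matrix N L A'" "N \<ge> 1"
  obtains U where "det U = 1" "A' = U ** A"
proof -
  obtain U where U: "A' = U ** A"
    using lat_subset_imp_factor assms by (metis is_lattice_matrix_iff order_refl)
  have "det U = 1" using arg_cong[OF U, of det] assms by (simp add: det_mul is_lattice_matrix_iff)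
  then show ?thesis using that U by blast
qed

section \<open>Stabilisers of sublattices\<close>

interpretation SL2Z: group SL2Z by (rule group_SL2Z)

lemma SL2Z_simps [simp]:
  "A \<in> carrier SL2Z \<longleftrightarrow> det A = 1" "A \<otimes>\<^bsub>SL2Z\<^esub> B = A ** B" "\<one>\<^bsub>SL2Z\<^esub> = mat 1"
  by (simp_all add: SL2Z_def)

lemma SL2Z_inv:
  assumes "det g = 1"
  shows "det (inv\<^bsub>SL2Z\<^esub> g) = 1" "g ** inv\<^bsub>SL2Z\<^esub> g = mat 1" "inv\<^bsub>SL2Z\<^esub> g ** g = mat 1"
  using SL2Z.inv_closed[of g] SL2Z.r_inv[of g] SL2Z.l_inv[of g] assms by simp_all

lemma det_SL2Z_pow: "det a = 1 \<Longrightarrow> det (a [^]\<^bsub>SL2Z\<^esub> (k::nat)) = 1"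
  using SL2Z.nat_pow_closed[of a k] by simp

lemma mem_stab_iff: "g \<in> lattice_stab L \<longleftrightarrow> det g = 1 \<and> lattice_act L g = L"
  by (simp add: lattice_stab_def)

lemma lattice_act_undo: "det g = 1 \<Longrightarrow> lattice_act (lattice_act L g) (inv\<^bsub>SL2Z\<^esub> g) = L"
  by (simp add: lattice_act_act SL2Z_inv lattice_act_one)

lemma subgroup_stab: "subgroup (lattice_stab L) SL2Z"
proof (rule SL2Z.subgroupI)
  have "mat 1 \<in> lattice_stab L"
    by (simp add: mem_stab_iff lattice_act_one)
  then show "lattice_stab L \<noteq> {}" by blast
  fix g assume g: "g \<in> lattice_stab L"
  then show "inv\<^bsub>SL2Z\<^esub> g \<in> lattice_stab L"
    using lattice_act_undo[of g L] by (simp add: mem_stab_iff SL2Z_inv)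
  fix h assume "h \<in> lattice_stab L"
  then show "g \<otimes>\<^bsub>SL2Z\<^esub> h \<in> lattice_stab L"
    using g by (simp add: mem_stab_iff det_mul flip: lattice_act_act)
qed (auto simp: mem_stab_iff)

lemma lattice_act_eq_iff:
  assumes "det g = 1" "det h = 1"
  shows "lattice_act L (g ** inv\<^bsub>SL2Z\<^esub> h) = L \<longleftrightarrow> lattice_act L g = lattice_act L h"
proof
  assume "lattice_act L (g ** inv\<^bsub>SL2Z\<^esub> h) = L"
  then have "lattice_act L h = lattice_act (lattice_act L (g ** inv\<^bsub>SL2Z\<^esub> h)) h" by simp
  then show "lattice_act L g = lattice_act L h"
    using assms by (simp add: lattice_act_act SL2Z_inv flip: matrix_mul_assoc)
next
  assume "lattice_act L g = lattice_act L h"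
  then show "lattice_act L (g ** inv\<^bsub>SL2Z\<^esub> h) = L"
    using assms by (simp add: SL2Z_inv lattice_act_one flip: lattice_act_act)
      (simp add: SL2Z_inv lattice_act_one lattice_act_act)
qed

text \<open>Orbit-stabiliser for a right action: the right coset of \<open>g\<close> corresponds to
  the lattice L g.\<close>

lemma stab_coset_eq_iff:
  assumes "det g = 1" "det h = 1"
  shows "lattice_stab L #>\<^bsub>SL2Z\<^esub> g = lattice_stab L #>\<^bsub>SL2Z\<^esub> h \<longleftrightarrow> lattice_act L g = lattice_act L h"
proof -
  have sub: "lattice_stab L \<subseteq> carrier SL2Z" using subgroup.subset[OF subgroup_stab] .
  have k: "det (g ** inv\<^bsub>SL2Z\<^esub> h) = 1" using assms by (simp add: SL2Z_inv det_mul)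
  have "lattice_stab L #>\<^bsub>SL2Z\<^esub> g = lattice_stab L #>\<^bsub>SL2Z\<^esub> h
      \<longleftrightarrow> lattice_stab L #>\<^bsub>SL2Z\<^esub> (g ** inv\<^bsub>SL2Z\<^esub> h) = lattice_stab L"
    using SL2Z.coset_mult_inv1[OF _ _ _ sub, of g h] SL2Z.coset_mult_inv2[OF _ _ _ sub, of g h] assms
    by auto
  also have "\<dots> \<longleftrightarrow> g ** inv\<^bsub>SL2Z\<^esub> h \<in> lattice_stab L"
    using SL2Z.coset_join1[OF _ _ subgroup_stab, of L "g ** inv\<^bsub>SL2Z\<^esub> h"]
      SL2Z.coset_join2[OF _ subgroup_stab, of "g ** inv\<^bsub>SL2Z\<^esub> h" L] k
    by auto
  finally have "lattice_stab L #>\<^bsub>SL2Z\<^esub> g = lattice_stab L #>\<^bsub>SL2Z\<^esub> h \<longleftrightarrow> g ** inv\<^bsub>SL2Z\<^esub> h \<in> lattice_stab L" .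
  then show ?thesis
    using lattice_act_eq_iff[OF assms] assms by (simp add: mem_stab_iff det_mul SL2Z_inv)
qed

lemma is_lattice_matrix_act:
  assumes "is_lattice_matrix N L A" "det g = 1"
  shows "is_lattice_matrix N (lattice_act L g) (A ** g)"
  using assms by (simp add: is_lattice_matrix_iff lattice_act_lat det_mul)

lemma lattice_act_sublattice:
  assumes "L \<in> sublattices N" "N \<ge> 1" "det g = 1"
  shows "lattice_act L g \<in> sublattices N"
  using sublattice_matrix_exists[OF assms(1,2)] is_lattice_matrix_act[OF _ assms(3)]
    is_lattice_matrixD[OF _ assms(2)] by blast

text \<open>A coset is recovered from the lattice L g, which again has index \<open>N\<close>, and
  there are finitely many such lattices.\<close>

lemma finite_rcosets_stab:
  assumes "L \<in> sublattices N" "N \<ge> 1"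
  shows "finite (rcosets\<^bsub>SL2Z\<^esub> (lattice_stab L))"
proof -
  let ?f = "\<lambda>M. lattice_stab L #>\<^bsub>SL2Z\<^esub> (SOME g. det g = 1 \<and> lattice_act L g = M)"
  have "rcosets\<^bsub>SL2Z\<^esub> (lattice_stab L) \<subseteq> ?f ` sublattices N"
  proof
    fix c assume "c \<in> rcosets\<^bsub>SL2Z\<^esub> (lattice_stab L)"
    then obtain g where g: "det g = 1" "c = lattice_stab L #>\<^bsub>SL2Z\<^esub> g"
      by (auto simp: RCOSETS_def)
    let ?h = "SOME h. det h = 1 \<and> lattice_act L h = lattice_act L g"
    have "det ?h = 1 \<and> lattice_act L ?h = lattice_act L g"
      by (rule someI[of _ g]) (use g in simp)
    then have "c = ?f (lattice_act L g)"
      using stab_coset_eq_iff[of ?h g L] g by simp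
    then show "c \<in> ?f ` sublattices N"
      using lattice_act_sublattice[OF assms g(1)] by blast
  qed
  then show ?thesis using finite_subset finite_sublattices[OF assms(2)] by blast
qed

section \<open>Conjugation by lattice matrices\<close>

lemma rat_matrix_mult: "rat_matrix (A ** B) = rat_matrix A ** rat_matrix B"
  by (simp add: rat_matrix_def matrix_matrix_mult_def vec_eq_iff)

lemma rat_matrix_eq_iff: "rat_matrix A = rat_matrix B \<longleftrightarrow> A = B"
  by (simp add: rat_matrix_def vec_eq_iff)

lemma rat_conj_eq:
  assumes "det A \<noteq> 0" "B ** A = A ** g"
  shows "rat_matrix B = rat_conj A g"
proof -
  have "det (rat_matrix A) = of_int (det A)"
    by (simp add: rat_matrix_def det_2)
  then have "invertible (rat_matrix A)" using assms(1) by (simp add: invertible_det_nz)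
  then have inv: "rat_matrix A ** matrix_inv (rat_matrix A) = mat 1"
    unfolding invertible_def matrix_inv_def by (rule someI2_ex) simp
  have "rat_conj A g = rat_matrix B ** (rat_matrix A ** matrix_inv (rat_matrix A))"
    unfolding rat_conj_def using assms(2) by (simp add: matrix_mul_assoc flip: rat_matrix_mult)
  then show ?thesis by (simp add: inv)
qed

text \<open>\<open>B ** A = A ** g\<close> is the fraction-free form of B = A g A^-1; through this
  lemma later arguments never touch rational matrices.\<close>

lemma hecke_conj_eq:
  assumes "det A \<noteq> 0" "B ** A = A ** g"
  shows "hecke_conj A g = B"
  unfolding hecke_conj_def
  using rat_conj_eq[OF assms] by (intro the_equality) (simp_all flip: rat_matrix_eq_iff)

text \<open>If \<open>g\<close> fixes \<open>L\<close>, then \<open>A ** g\<close> is another matrix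
  of \<open>L\<close> with the same determinant, so it equals \<open>B ** A\<close> with
  \<open>B\<close> in SL2(Z). This is the integrality of A g A^-1.\<close>

lemma stab_conjugate:
  assumes A: "is_lattice_matrix N L A" and N: "N \<ge> 1" and g: "g \<in> lattice_stab L"
  shows "det (hecke_conj A g) = 1" "hecke_conj A g ** A = A ** g"
    "rat_matrix (hecke_conj A g) = rat_conj A g"
proof -
  have "is_lattice_matrix N L (A ** g)"
    using is_lattice_matrix_act[OF A, of g] g by (simp add: mem_stab_iff)
  then obtain B where B: "det B = 1" "A ** g = B ** A"
    using is_lattice_matrix_unique[OF A _ N] by metis
  have "det A \<noteq> 0" using A N by (simp add: is_lattice_matrix_iff)
  then have "hecke_conj A g = B" "rat_matrix B = rat_conj A g"
    using hecke_conj_eq[of A B g] rat_conj_eq[of A B g] B by simp_all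
  then show "det (hecke_conj A g) = 1" "hecke_conj A g ** A = A ** g"
    "rat_matrix (hecke_conj A g) = rat_conj A g"
    using B by simp_all
qed

lemma hecke_conj_hom:
  assumes A: "is_lattice_matrix N L A" and N: "N \<ge> 1"
  shows "hecke_conj A \<in> hom (stab_group L) SL2Z"
proof (rule homI)
  have det: "det A \<noteq> 0" using A N by (simp add: is_lattice_matrix_iff)
  note sc = stab_conjugate[OF A N]
  fix g assume g: "g \<in> carrier (stab_group L)"
  then show "hecke_conj A g \<in> carrier SL2Z" using sc(1) by simp
  fix h assume h: "h \<in> carrier (stab_group L)"
  have "(hecke_conj A g ** hecke_conj A h) ** A = hecke_conj A g ** (hecke_conj A h ** A)"
    by (simp add: matrix_mul_assoc)
  also have "\<dots> = (hecke_conj A g ** A) ** h"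
    using sc(2)[of h] h by (simp add: matrix_mul_assoc)
  also have "\<dots> = A ** (g ** h)"
    using sc(2)[of g] g by (simp add: matrix_mul_assoc)
  finally show "hecke_conj A (g \<otimes>\<^bsub>stab_group L\<^esub> h) = hecke_conj A g \<otimes>\<^bsub>SL2Z\<^esub> hecke_conj A h"
    using hecke_conj_eq[OF det] by simp
qed

section \<open>The Hecke operators as sums over all sublattices\<close>

text \<open>The size of the orbit of \<open>L\<close> under the powers of \<open>a\<close>, encoded
  as a return time at the identity so that the general results on return times apply.\<close>

definition period :: "int^2^2 \<Rightarrow> (int^2) set \<Rightarrow> nat" where
  "period a L = return_time SL2Z (lattice_stab L) a (mat 1)"

definition hecke_class :: "nat \<Rightarrow> int^2^2 \<Rightarrow> (int^2) set \<Rightarrow> (int^2^2) set" where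
  "hecke_class N a L =
     conj_class SL2Z (hecke_conj (SOME A. is_lattice_matrix N L A) (a [^]\<^bsub>SL2Z\<^esub> period a L))"

lemma period:
  assumes L: "L \<in> sublattices N" and N: "N \<ge> 1" and a: "det a = 1"
  shows "0 < period a L"
    and "lattice_act L (a [^]\<^bsub>SL2Z\<^esub> (k::nat)) = L \<longleftrightarrow> period a L dvd k"
proof -
  note fin = finite_rcosets_stab[OF L N]
  show "0 < period a L"
    unfolding period_def using SL2Z.return_time(1)[OF subgroup_stab fin, of a "mat 1"] a by simp
  show "lattice_act L (a [^]\<^bsub>SL2Z\<^esub> (k::nat)) = L \<longleftrightarrow> period a L dvd k"
    unfolding period_def using SL2Z.return_time_nat[OF subgroup_stab fin, of a "mat 1" k] a
      SL2Z.inv_one by (simp add: mem_stab_iff det_SL2Z_pow)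
qed

lemma period_eqI:
  assumes L: "L \<in> sublattices N" and N: "N \<ge> 1" and a: "det a = 1"
    and d: "\<And>k. lattice_act L (a [^]\<^bsub>SL2Z\<^esub> (k::nat)) = L \<longleftrightarrow> d dvd k"
  shows "period a L = d"
  using period(2)[OF L N a] d by (metis dvd_antisym dvd_refl)

lemma period_mem_stab:
  assumes "L \<in> sublattices N" "N \<ge> 1" "det a = 1"
  shows "a [^]\<^bsub>SL2Z\<^esub> period a L \<in> lattice_stab L"
  using period(2)[OF assms, of "period a L"] assms by (simp add: mem_stab_iff det_SL2Z_pow)

lemma SL2Z_conj_class_eqI:
  assumes "det U = 1" "det x = 1" "y ** U = U ** x"
  shows "conj_class SL2Z y = conj_class SL2Z x"
proof -
  have "y = (y ** U) ** inv\<^bsub>SL2Z\<^esub> U"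
    using assms(1) by (simp add: SL2Z_inv flip: matrix_mul_assoc)
  then show ?thesis
    using SL2Z.conj_class_conj[of x U] assms by simp
qed

text \<open>Conjugation by \<open>U ** A\<close> is conjugation by \<open>A\<close> followed by
  conjugation by \<open>U\<close> in SL2(Z), so every matrix of the lattice gives the same
  class.\<close>

lemma hecke_class_eq:
  assumes A: "is_lattice_matrix N L A" and N: "N \<ge> 1" and a: "det a = 1"
  shows "hecke_class N a L = conj_class SL2Z (hecke_conj A (a [^]\<^bsub>SL2Z\<^esub> period a L))"
proof -
  define A' where "A' = (SOME A. is_lattice_matrix N L A)"
  have A': "is_lattice_matrix N L A'" unfolding A'_def using A by (rule someI)
  obtain U where U: "det U = 1" "A' = U ** A"
    using is_lattice_matrix_unique[OF A A' N] .
  define g where "g = a [^]\<^bsub>SL2Z\<^esub> period a L"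
  have g: "g \<in> lattice_stab L"
    unfolding g_def by (rule period_mem_stab[OF is_lattice_matrixD[OF A N] N a])
  have "(hecke_conj A' g ** U) ** A = (U ** hecke_conj A g) ** A"
    using stab_conjugate(2)[OF A N g] stab_conjugate(2)[OF A' N g]
    by (simp add: U flip: matrix_mul_assoc)
  moreover have "det A \<noteq> 0" using A N by (simp add: is_lattice_matrix_iff)
  ultimately have "hecke_conj A' g ** U = U ** hecke_conj A g"
    using matrix_mult_right_cancel by blast
  then show ?thesis
    unfolding hecke_class_def A'_def[symmetric] g_def[symmetric]
    using SL2Z_conj_class_eqI[OF U(1) stab_conjugate(1)[OF A N g]] by simp
qed

lemma induced_map_frag_eval:
  "frag_eval f (induced_map G G' \<psi> z) = frag_eval (\<lambda>C. f (THE D. D \<in> conj_classes G' \<and> \<psi> ` C \<subseteq> D)) z"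
  unfolding induced_map_def frag_eval_frag_extend by simp

text \<open>The term at the coset of \<open>g\<close> depends only on M = L g: \<open>A ** g\<close>
  is a matrix of M, the return time at \<open>g\<close> is the period of M, and A (g x g^-1) A^-1 =
  (A g) x (A g)^-1. The base lattice \<open>L\<close> and the matrix \<open>A\<close> leave the
  formula.\<close>

lemma hecke_sum_term:
  assumes L: "L \<in> sublattices N" and N: "N \<ge> 1" and A: "is_lattice_matrix N L A" and a: "det a = 1"
    and r: "\<And>c. c \<in> rcosets\<^bsub>SL2Z\<^esub> (lattice_stab L) \<Longrightarrow> r c \<in> c"
  shows "frag_eval f (induced_map (stab_group L) SL2Z (hecke_conj A)
           (pullback SL2Z (lattice_stab L) (frag_of (conj_class SL2Z a))))
       = (\<Sum>c\<in>rcosets\<^bsub>SL2Z\<^esub> (lattice_stab L).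
           f (hecke_class N a (lattice_act L (r c))) / period a (lattice_act L (r c)))"
proof -
  let ?H = "lattice_stab L" and ?ps = "\<lambda>C. THE D. D \<in> conj_classes SL2Z \<and> hecke_conj A ` C \<subseteq> D"
  note fin = finite_rcosets_stab[OF L N]
  have "frag_eval f (induced_map (stab_group L) SL2Z (hecke_conj A)
           (pullback SL2Z ?H (frag_of (conj_class SL2Z a))))
      = (\<Sum>c\<in>rcosets\<^bsub>SL2Z\<^esub> ?H. f (?ps (SL2Z.loop_class ?H a (r c))) / return_time SL2Z ?H a (r c))"
    unfolding induced_map_frag_eval using a by (intro SL2Z.frag_eval_pullback subgroup_stab fin r) auto
  also have "\<dots> = (\<Sum>c\<in>rcosets\<^bsub>SL2Z\<^esub> ?H.
           f (hecke_class N a (lattice_act L (r c))) / period a (lattice_act L (r c)))"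
  proof (rule sum.cong[OF refl])
    fix c assume c: "c \<in> rcosets\<^bsub>SL2Z\<^esub> ?H"
    define g where "g = r c"
    have g: "det g = 1"
    proof -
      obtain x where x: "det x = 1" "c = ?H #>\<^bsub>SL2Z\<^esub> x" using c by (auto simp: RCOSETS_def)
      then show ?thesis
        using r[OF c] subgroup.elemrcos_carrier[OF subgroup_stab group_SL2Z, of x g L] by (simp add: g_def)
    qed
    define M where "M = lattice_act L g"
    have M: "M \<in> sublattices N" unfolding M_def by (rule lattice_act_sublattice[OF L N g])
    have AM: "is_lattice_matrix N M (A ** g)"
      unfolding M_def by (rule is_lattice_matrix_act[OF A g])
    \<comment> \<open>g a^k g^-1 fixes \<open>L\<close> exactly if a^k fixes L g.\<close>
    have "lattice_act M (a [^]\<^bsub>SL2Z\<^esub> k) = M \<longleftrightarrow> return_time SL2Z ?H a g dvd k" for k :: nat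
      using SL2Z.return_time_nat[OF subgroup_stab fin, of a g k] a g
        lattice_act_eq_iff[of "g ** a [^]\<^bsub>SL2Z\<^esub> k" g L]
      by (simp add: mem_stab_iff det_mul det_SL2Z_pow SL2Z_inv M_def lattice_act_act)
    then have p: "period a M = return_time SL2Z ?H a g" by (intro period_eqI[OF M N a])
    define x where "x = a [^]\<^bsub>SL2Z\<^esub> period a M"
    have xM: "x \<in> lattice_stab M" unfolding x_def by (rule period_mem_stab[OF M N a])
    have xd: "det x = 1" using xM by (simp add: mem_stab_iff)
    have xL: "g ** x ** inv\<^bsub>SL2Z\<^esub> g \<in> ?H"
      using SL2Z.loop_mem[OF subgroup_stab fin, of a g] a g by (simp add: x_def p)
    have "?ps (SL2Z.loop_class ?H a g) = conj_class SL2Z (hecke_conj A (g ** x ** inv\<^bsub>SL2Z\<^esub> g))"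
    proof -
      have "SL2Z.loop_class ?H a g = conj_class (stab_group L) (g ** x ** inv\<^bsub>SL2Z\<^esub> g)"
        unfolding SL2Z.loop_class_def x_def p by simp
      moreover have "frag_of (?ps (conj_class (stab_group L) (g ** x ** inv\<^bsub>SL2Z\<^esub> g)))
          = frag_of (conj_class SL2Z (hecke_conj A (g ** x ** inv\<^bsub>SL2Z\<^esub> g)))"
        using induced_map_frag_of[OF SL2Z.subgroup_imp_group[OF subgroup_stab] group_SL2Z hecke_conj_hom[OF A N],
            of "g ** x ** inv\<^bsub>SL2Z\<^esub> g"] xL
        by (simp add: induced_map_def)
      ultimately show ?thesis by (simp add: frag_of_eq)
    qed
    also have "hecke_conj A (g ** x ** inv\<^bsub>SL2Z\<^esub> g) = hecke_conj (A ** g) x"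
    proof (rule hecke_conj_eq)
      show "det A \<noteq> 0" using A N by (simp add: is_lattice_matrix_iff)
      have "hecke_conj (A ** g) x ** A = (hecke_conj (A ** g) x ** (A ** g)) ** inv\<^bsub>SL2Z\<^esub> g"
        using g by (simp add: SL2Z_inv flip: matrix_mul_assoc)
      also have "\<dots> = A ** (g ** x ** inv\<^bsub>SL2Z\<^esub> g)"
        using stab_conjugate(2)[OF AM N xM] by (simp add: matrix_mul_assoc)
      finally show "hecke_conj (A ** g) x ** A = A ** (g ** x ** inv\<^bsub>SL2Z\<^esub> g)" .
    qed
    also have "conj_class SL2Z (hecke_conj (A ** g) x) = hecke_class N a M"
      unfolding x_def by (rule hecke_class_eq[OF AM N a, symmetric])
    finally show "f (?ps (SL2Z.loop_class ?H a (r c))) / return_time SL2Z ?H a (r c) =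
      f (hecke_class N a (lattice_act L (r c))) / period a (lattice_act L (r c))"
      by (simp add: p g_def[symmetric] M_def[symmetric])
  qed
  finally show ?thesis .
qed

text \<open>Orbit-stabiliser: the pairs of a chosen orbit representative \<open>L\<close> and a coset of its
  stabiliser correspond to all sublattices, so no trace of the choices remains.\<close>

lemma frag_eval_hecke_sum:
  assumes RA: "hecke_choice N R A" and N: "N \<ge> 1" and a: "det a = 1"
  shows "frag_eval f (hecke_sum R A (frag_of (conj_class SL2Z a)))
       = (\<Sum>L\<in>sublattices N. f (hecke_class N a L) / period a L)"
proof -
  have R: "R \<subseteq> sublattices N"
    and ex1: "\<And>L. L \<in> sublattices N \<Longrightarrow> \<exists>!L'. L' \<in> R \<and> (\<exists>g\<in>carrier SL2Z. L' = lattice_act L g)"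
    and A: "\<And>L. L \<in> R \<Longrightarrow> is_lattice_matrix N L (A L)"
    using RA by (simp_all add: hecke_choice_def)
  have finR: "finite R" using R finite_sublattices[OF N] finite_subset by blast
  define r where "r c = (SOME x. x \<in> c)" for c :: "(int^2^2) set"
  have r: "r c \<in> c" "det (r c) = 1" "c = lattice_stab L #>\<^bsub>SL2Z\<^esub> r c"
    if c: "c \<in> rcosets\<^bsub>SL2Z\<^esub> (lattice_stab L)" for c L
  proof -
    obtain x where x: "x \<in> carrier SL2Z" "c = lattice_stab L #>\<^bsub>SL2Z\<^esub> x"
      using c by (auto simp: RCOSETS_def)
    have "x \<in> c" using x SL2Z.rcos_self[OF _ subgroup_stab] by simp
    then show rc: "r c \<in> c" unfolding r_def by (rule someI)
    then show "det (r c) = 1"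
      using subgroup.elemrcos_carrier[OF subgroup_stab group_SL2Z x(1), of "r c" L] x(2) by simp
    show "c = lattice_stab L #>\<^bsub>SL2Z\<^esub> r c"
      using SL2Z.repr_independence[OF _ x(1) subgroup_stab, of "r c" L] x(2) rc by simp
  qed
  let ?X = "SIGMA L:R. rcosets\<^bsub>SL2Z\<^esub> (lattice_stab L)"
  let ?act = "\<lambda>(L, c). lattice_act L (r c)"
  let ?F = "\<lambda>L. f (hecke_class N a L) / period a L"
  have "bij_betw ?act ?X (sublattices N)"
    unfolding bij_betw_def
  proof (intro conjI inj_onI equalityI subsetI)
    fix p q assume pq: "p \<in> ?X" "q \<in> ?X" "?act p = ?act q"
    obtain L c L' c' where p: "p = (L, c)" "q = (L', c')" by fastforce
    have L: "L \<in> R" "L' \<in> R" using pq p by auto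
    have c: "c \<in> rcosets\<^bsub>SL2Z\<^esub> (lattice_stab L)" "c' \<in> rcosets\<^bsub>SL2Z\<^esub> (lattice_stab L')" using pq p by auto
    define M where "M = lattice_act L (r c)"
    have M': "M = lattice_act L' (r c')" using pq p by (simp add: M_def)
    have "M \<in> sublattices N"
      unfolding M_def using lattice_act_sublattice[OF _ N r(2)[OF c(1)]] L R by blast
    moreover have "\<exists>g\<in>carrier SL2Z. L = lattice_act M g"
      unfolding M_def using lattice_act_undo r(2)[OF c(1)] SL2Z_inv(1) by (metis SL2Z_simps(1))
    moreover have "\<exists>g\<in>carrier SL2Z. L' = lattice_act M g"
      unfolding M' using lattice_act_undo r(2)[OF c(2)] SL2Z_inv(1) by (metis SL2Z_simps(1))
    ultimately have "L = L'" using ex1 L by blast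
    then have "lattice_stab L #>\<^bsub>SL2Z\<^esub> r c = lattice_stab L #>\<^bsub>SL2Z\<^esub> r c'"
      using stab_coset_eq_iff[OF r(2)[OF c(1)] r(2)[OF c(2)]] M' by (simp add: M_def)
    then have "c = c'" using r(3)[OF c(1)] r(3)[OF c(2)] \<open>L = L'\<close> by simp
    then show "p = q" using p \<open>L = L'\<close> by simp
  next
    fix M assume "M \<in> ?act ` ?X"
    then obtain L c where "L \<in> R" "c \<in> rcosets\<^bsub>SL2Z\<^esub> (lattice_stab L)" "M = lattice_act L (r c)" by auto
    then show "M \<in> sublattices N" using lattice_act_sublattice[OF _ N r(2)] R by blast
  next
    fix M assume "M \<in> sublattices N"
    then have "\<exists>L. L \<in> R \<and> (\<exists>g\<in>carrier SL2Z. L = lattice_act M g)" by (rule ex1_implies_ex[OF ex1])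
    then obtain L g where L: "L \<in> R" "det g = 1" "L = lattice_act M g" by auto
    \<comment> \<open>Since L = M g, the lattice M is reached from the representative L by
      g^-1.\<close>
    define c where "c = lattice_stab L #>\<^bsub>SL2Z\<^esub> inv\<^bsub>SL2Z\<^esub> g"
    have c: "c \<in> rcosets\<^bsub>SL2Z\<^esub> (lattice_stab L)"
      using L(2) by (auto simp: c_def RCOSETS_def SL2Z_inv)
    have "lattice_act L (r c) = lattice_act L (inv\<^bsub>SL2Z\<^esub> g)"
      using stab_coset_eq_iff[OF r(2)[OF c] SL2Z_inv(1)[OF L(2)], of L] r(3)[OF c]
      by (simp only: c_def[symmetric] simp_thms)
    also have "\<dots> = M" using lattice_act_undo L by simp
    finally show "M \<in> ?act ` ?X" using L c by force
  qed
  from sum.reindex_bij_betw[OF this, of ?F]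
  have "(\<Sum>L\<in>sublattices N. ?F L) = (\<Sum>p\<in>?X. ?F (?act p))" ..
  also have "\<dots> = (\<Sum>(L, c)\<in>?X. ?F (lattice_act L (r c)))"
    by (rule sum.cong) auto
  also have "\<dots> = (\<Sum>L\<in>R. \<Sum>c\<in>rcosets\<^bsub>SL2Z\<^esub> (lattice_stab L). ?F (lattice_act L (r c)))"
    by (rule sum.Sigma[symmetric]) (use finR finite_rcosets_stab[OF _ N] R in auto)
  also have "\<dots> = frag_eval f (hecke_sum R A (frag_of (conj_class SL2Z a)))"
    unfolding hecke_sum_def frag_eval_sum
    using R A a hecke_sum_term[OF _ N, where r = r and f = f] r(1) by (intro sum.cong) auto
  finally show ?thesis ..
qed

section \<open>Existence and irrelevance of the choices\<close>

text \<open>The representative is chosen from the orbit as a set, so lattices in one orbit receive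
  literally the same one. Existence gives meaning to the choice made in
  \<open>hecke\<close>.\<close>

lemma hecke_choice_exists:
  assumes N: "N \<ge> 1"
  shows "\<exists>R A. hecke_choice N R A"
proof -
  define orb where "orb L = lattice_act L ` carrier SL2Z" for L
  define rep where "rep L = (SOME L'. L' \<in> orb L)" for L
  have rep: "rep L \<in> orb L" for L
    unfolding rep_def by (rule someI[of _ "lattice_act L (mat 1)"]) (auto simp: orb_def)
  have orb_eq: "orb L' = orb L" if L': "L' \<in> orb L" for L L'
  proof -
    have sub: "orb L' \<subseteq> orb L" if L': "L' \<in> orb L" for L L'
      using that unfolding orb_def by (auto simp: lattice_act_act det_mul intro!: imageI)
    obtain g where g: "det g = 1" "L' = lattice_act L g" using L' by (auto simp: orb_def)
    have "L \<in> orb L'" unfolding g(2) orb_def using lattice_act_undo[OF g(1), of L] SL2Z_inv(1)[OF g(1)]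
      by (metis SL2Z_simps(1) image_eqI)
    then show ?thesis using sub L' by blast
  qed
  define A where "A L = (SOME A. is_lattice_matrix N L A)" for L
  have sub: "rep L \<in> sublattices N" if "L \<in> sublattices N" for L
    using rep[of L] lattice_act_sublattice[OF that N] by (auto simp: orb_def)
  have "hecke_choice N (rep ` sublattices N) A"
    unfolding hecke_choice_def
  proof (intro conjI ballI)
    show "rep ` sublattices N \<subseteq> sublattices N" using sub by blast
    fix L assume L: "L \<in> rep ` sublattices N"
    show "is_lattice_matrix N L (A L)"
      unfolding A_def by (rule someI_ex) (use sublattice_matrix_exists[OF _ N] sub L in blast)
  next
    fix L assume L: "L \<in> sublattices N"
    have iff: "(\<exists>g\<in>carrier SL2Z. L' = lattice_act L g) \<longleftrightarrow> L' \<in> orb L" for L'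
      by (auto simp: orb_def)
    show "\<exists>!L'. L' \<in> rep ` sublattices N \<and> (\<exists>g\<in>carrier SL2Z. L' = lattice_act L g)"
      unfolding iff
    proof (rule ex1I[of _ "rep L"])
      show "rep L \<in> rep ` sublattices N \<and> rep L \<in> orb L" using L rep by blast
      fix L' assume "L' \<in> rep ` sublattices N \<and> L' \<in> orb L"
      then obtain M where M: "L' = rep M" "rep M \<in> orb L" by blast
      have "orb M = orb L" using orb_eq[OF rep[of M]] orb_eq[OF M(2)] by simp
      then show "L' = rep L" using M by (simp add: rep_def)
    qed
  qed
  then show ?thesis by blast
qed

lemma hecke_sum_in_hom:
  assumes RA: "hecke_choice N R A" and N: "N \<ge> 1"
  shows "hecke_sum R A \<in> hom (Zlambda SL2Z) (Zlambda SL2Z)"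
proof (rule homI)
  have term_hom: "induced_map (stab_group L) SL2Z (hecke_conj (A L)) \<in> hom (Zlambda (stab_group L)) (Zlambda SL2Z)"
    "pullback SL2Z (lattice_stab L) \<in> hom (Zlambda SL2Z) (Zlambda (stab_group L))" if "L \<in> R" for L
  proof -
    have "L \<in> sublattices N" "is_lattice_matrix N L (A L)" using RA that by (auto simp: hecke_choice_def)
    then show "induced_map (stab_group L) SL2Z (hecke_conj (A L)) \<in> hom (Zlambda (stab_group L)) (Zlambda SL2Z)"
      "pullback SL2Z (lattice_stab L) \<in> hom (Zlambda SL2Z) (Zlambda (stab_group L))"
      using induced_map_in_hom[OF SL2Z.subgroup_imp_group[OF subgroup_stab] group_SL2Z hecke_conj_hom[OF _ N]]
        SL2Z.pullback_in_hom[OF subgroup_stab finite_rcosets_stab[OF _ N]] by blast+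
  qed
  fix z assume z: "z \<in> carrier (Zlambda SL2Z)"
  show "hecke_sum R A z \<in> carrier (Zlambda SL2Z)"
    unfolding hecke_sum_def Zlambda_def[of SL2Z]
    using hom_in_carrier[OF term_hom(1) hom_in_carrier[OF term_hom(2) z]]
    by (intro sum_closed_free_Abelian_group) (simp add: Zlambda_def)
  show "hecke_sum R A (z \<otimes>\<^bsub>Zlambda SL2Z\<^esub> w) = hecke_sum R A z \<otimes>\<^bsub>Zlambda SL2Z\<^esub> hecke_sum R A w" for w
    by (simp add: hecke_sum_def Zlambda_def induced_map_def pullback_def frag_extend_add sum.distrib)
qed

lemma hecke_sum_diff: "hecke_sum R A (x - y) = hecke_sum R A x - hecke_sum R A y"
  by (simp add: hecke_sum_def induced_map_def pullback_def frag_extend_diff sum_subtractf)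

text \<open>Differences of single classes, starting from 0, reach every formal sum, so an identity
  between additive maps is checked on one class.\<close>

lemma Zlambda_induct [consumes 1, case_names zero frag_of diff]:
  assumes "z \<in> carrier (Zlambda G)" "P 0" "\<And>x. x \<in> carrier G \<Longrightarrow> P (frag_of (conj_class G x))"
    "\<And>x y. P x \<Longrightarrow> P y \<Longrightarrow> P (x - y)"
  shows "P z"
  using assms(1) unfolding Zlambda_def carrier_free_Abelian_group_iff
  by (induction z rule: frag_induction) (use assms in \<open>auto simp: conj_classes_def\<close>)

text \<open>The first conjunct carries no condition on \<open>N\<close>, which makes additivity of
  \<open>hecke N\<close> unconditional; only the validity of the choice needs
  \<open>N \<ge> 1\<close>.\<close>

lemma hecke_eq_hecke_sum:
  "\<exists>R A. hecke N = hecke_sum R A \<and> (N \<ge> 1 \<longrightarrow> hecke_choice N R A)"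
proof -
  define p where "p = (SOME (R, A). hecke_choice N R A)"
  have "hecke_choice N (fst p) (snd p)" if "N \<ge> 1"
  proof -
    have "\<exists>p. case p of (R, A) \<Rightarrow> hecke_choice N R A" using hecke_choice_exists[OF that] by auto
    then have "case p of (R, A) \<Rightarrow> hecke_choice N R A" unfolding p_def by (rule someI_ex)
    then show ?thesis by (simp only: case_prod_beta)
  qed
  moreover have "hecke N = hecke_sum (fst p) (snd p)"
    unfolding hecke_def p_def[symmetric] by (simp add: case_prod_beta)
  ultimately show ?thesis by blast
qed

lemma hecke_0 [simp]: "hecke N 0 = 0" and hecke_diff: "hecke N (x - y) = hecke N x - hecke N y"
proof -
  obtain R A where "hecke N = hecke_sum R A" using hecke_eq_hecke_sum by blast
  then show "hecke N (x - y) = hecke N x - hecke N y" for x y by (simp add: hecke_sum_diff)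
  from this[of 0 0] show "hecke N 0 = 0" by simp
qed

lemma frag_eval_hecke:
  assumes "N \<ge> 1" "det a = 1"
  shows "frag_eval f (hecke N (frag_of (conj_class SL2Z a)))
       = (\<Sum>L\<in>sublattices N. f (hecke_class N a L) / period a L)"
proof -
  obtain R A where "hecke N = hecke_sum R A" "hecke_choice N R A"
    using hecke_eq_hecke_sum assms by blast
  then show ?thesis using frag_eval_hecke_sum[OF _ assms] by simp
qed

lemma hecke_in_hom:
  assumes "N \<ge> 1"
  shows "hecke N \<in> hom (Zlambda SL2Z) (Zlambda SL2Z)"
proof -
  obtain R A where "hecke N = hecke_sum R A" "hecke_choice N R A"
    using hecke_eq_hecke_sum assms by blast
  then show ?thesis using hecke_sum_in_hom[OF _ assms] by simp
qed

text \<open>The sum over all sublattices in \<open>frag_eval_hecke_sum\<close> mentions neither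
  \<open>R\<close> nor \<open>A\<close>, so all valid choices have the same pairings.\<close>

lemma hecke_sum_eq_hecke:
  assumes RA: "hecke_choice N R A" and N: "N \<ge> 1" and z: "z \<in> carrier (Zlambda SL2Z)"
  shows "hecke N z = hecke_sum R A z"
  using z
proof (induction z rule: Zlambda_induct)
  case zero
  have "hecke_sum R A 0 = 0" using hecke_sum_diff[of R A 0 0] by simp
  then show ?case by simp
next
  case (frag_of a)
  then show ?case
    by (intro frag_eqI) (simp add: frag_eval_hecke_sum[OF RA N] frag_eval_hecke[OF N])
next
  case (diff x y)
  then show ?case by (simp add: hecke_diff hecke_sum_diff)
qed

section \<open>Multiplicativity\<close>

lemma scale_vector_mult: "(k *s v) v* A = k *s (v v* (A :: int^2^2))"
  by (simp add: vector_matrix_mult_def vec_eq_iff sum_distrib_left mult_ac)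

lemma scale_mem_sublattice:
  assumes "L \<in> sublattices N" "N \<ge> 1"
  shows "int N *s v \<in> L"
  using sublattice_matrix_exists[OF assms] det_mult_mem_lat by (metis is_lattice_matrix_iff)

lemma lattice_act_cancel:
  assumes "det A \<noteq> 0"
  shows "lattice_act K A = lattice_act K' A \<longleftrightarrow> K = K'"
  unfolding lattice_act_def
  by (rule inj_image_eq_iff) (auto intro: injI vector_mult_cancel[OF assms])

text \<open>\<open>K\<close> contains M Z^2, so K A contains M L. Conversely, if M v lies in K A, it
  lies in L, as does N v, and coprimality returns v itself.\<close>

lemma intermediate_lattice:
  assumes A: "is_lattice_matrix N L A" and K: "K \<in> sublattices M"
    and N: "N \<ge> 1" and M: "M \<ge> 1" and cop: "coprime M N"
  shows "{v. int M *s v \<in> lattice_act K A} = L"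
proof (intro equalityI subsetI CollectI)
  have L: "L \<in> sublattices N" by (rule is_lattice_matrixD[OF A N])
  then have subL: "subgroup L Z2" by (simp add: sublattices_def)
  have LA: "L = lat A" using A by (simp add: is_lattice_matrix_iff)
  fix v
  {
    assume "v \<in> {v. int M *s v \<in> lattice_act K A}"
    then have v: "int M *s v \<in> L" unfolding LA lattice_act_def lat_def by auto
    obtain x y where xy: "x * int M + y * int N = 1"
      using bezout_int[of "int M" "int N"] cop by (auto simp: coprime_iff_gcd_eq_1)
    have "v = (x * int M + y * int N) *s v" by (simp add: xy)
    also have "\<dots> = x *s (int M *s v) + y *s (int N *s v)"
      by (simp add: vec_eq_iff algebra_simps)
    also have "\<dots> \<in> L"
      using subgroup_Z2_add[OF subL] subgroup_Z2_scale[OF subL] v scale_mem_sublattice[OF L N] by blast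
    finally show "v \<in> L" .
  next
    assume "v \<in> L"
    then obtain w where "v = w v* A" unfolding LA lat_def by blast
    then have "int M *s v = (int M *s w) v* A" by (simp add: scale_vector_mult)
    then show "int M *s v \<in> lattice_act K A"
      using scale_mem_sublattice[OF K M] unfolding lattice_act_def by blast
  }
qed

text \<open>The divided lattice is defined from \<open>L'\<close> by scaling alone, and scaling
  commutes with matrices; the inverse of \<open>g\<close> supplies the second inclusion.\<close>

lemma stab_divided_lattice:
  assumes "g \<in> lattice_stab L'"
  shows "lattice_act {v. m *s v \<in> L'} g = {v. m *s v \<in> L'}"
proof -
  have mem: "m *s (v v* h) \<in> L'" if "m *s v \<in> L'" "h \<in> lattice_stab L'" for v h
  proof -
    have "(m *s v) v* h \<in> lattice_act L' h" using that(1) by (auto simp: lattice_act_def)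
    then show ?thesis using that(2) by (simp add: mem_stab_iff scale_vector_mult)
  qed
  have inv: "inv\<^bsub>SL2Z\<^esub> g \<in> lattice_stab L'"
    by (rule subgroup.m_inv_closed[OF subgroup_stab assms])
  have "v = (v v* inv\<^bsub>SL2Z\<^esub> g) v* g" for v
    using assms by (simp add: vector_matrix_mul_assoc SL2Z_inv mem_stab_iff)
  then show ?thesis
    unfolding lattice_act_def using mem[OF _ assms] mem[OF _ inv] by fast
qed

text \<open>Injectivity: \<open>intermediate_lattice\<close> recovers \<open>L\<close>, and then
  \<open>A L\<close> cancels. Surjectivity: with L = {v. M v in L'} and bases related by D = C B,
  coprimality distributes the determinant M N correctly over \<open>B\<close> and
  \<open>C\<close>.\<close>

lemma bij_betw_sublattice_pairs:
  assumes N: "N \<ge> 1" and M: "M \<ge> 1" and cop: "coprime M N"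
    and A: "\<And>L. L \<in> sublattices N \<Longrightarrow> is_lattice_matrix N L (A L)"
  shows "bij_betw (\<lambda>(L, K). lattice_act K (A L)) (sublattices N \<times> sublattices M) (sublattices (M * N))"
  unfolding bij_betw_def
proof (intro conjI inj_onI equalityI subsetI)
  have MN: "M * N \<ge> 1" using M N by simp
  note inter = intermediate_lattice[OF A _ N M cop]
  {
    fix p q assume pq: "p \<in> sublattices N \<times> sublattices M" "q \<in> sublattices N \<times> sublattices M"
      "(case p of (L, K) \<Rightarrow> lattice_act K (A L)) = (case q of (L, K) \<Rightarrow> lattice_act K (A L))"
    obtain L K L' K' where p: "p = (L, K)" "q = (L', K')" by fastforce
    have L: "L \<in> sublattices N" "L' \<in> sublattices N" "K \<in> sublattices M" "K' \<in> sublattices M"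
      and eq: "lattice_act K (A L) = lattice_act K' (A L')" using pq p by auto
    have "L = L'" using inter[OF L(1,3)] inter[OF L(2,4)] eq by simp
    moreover have "det (A L) \<noteq> 0" using A[OF L(1)] N by (simp add: is_lattice_matrix_iff)
    ultimately have "K = K'" using eq lattice_act_cancel by simp
    then show "p = q" using \<open>L = L'\<close> p by simp
  next
    fix L' assume "L' \<in> (\<lambda>(L, K). lattice_act K (A L)) ` (sublattices N \<times> sublattices M)"
    then obtain L K where L: "L \<in> sublattices N" "K \<in> sublattices M" "L' = lattice_act K (A L)" by auto
    obtain C where "is_lattice_matrix M K C" using sublattice_matrix_exists[OF L(2) M] by blast
    then have "is_lattice_matrix (M * N) L' (C ** A L)"
      using A[OF L(1)] L(3) by (simp add: is_lattice_matrix_iff lattice_act_lat det_mul)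
    then show "L' \<in> sublattices (M * N)" using is_lattice_matrixD MN by blast
  next
    fix L' assume L': "L' \<in> sublattices (M * N)"
    then have sub: "subgroup L' Z2" by (simp add: sublattices_def)
    obtain D where D: "is_lattice_matrix (M * N) L' D" using sublattice_matrix_exists[OF L' MN] by blast
    define L where "L = {v. int M *s v \<in> L'}"
    have "0 \<in> L" using sub by (simp add: L_def subgroup_Z2_iff)
    moreover have "x - y \<in> L" if "x \<in> L" "y \<in> L" for x y
    proof -
      have "int M *s (x - y) = int M *s x - int M *s y" by (simp add: vec_eq_iff algebra_simps)
      then show ?thesis using that subgroup_Z2_diff[OF sub] by (simp add: L_def)
    qed
    ultimately have subL: "subgroup L Z2" by (simp add: subgroup_Z2_iff)
    have NL: "int N *s v \<in> L" for v
      using scale_mem_sublattice[OF L' MN, of v] by (simp add: L_def vector_smult_assoc)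
    then have "\<exists>k>0. k *s v \<in> L" for v using N by (intro exI[of _ "int N"]) auto
    from subgroup_Z2_hnf[OF subL this] obtain a b d where
      abd: "0 < a" "0 < d" "L = lat (hnf a b d)" by metis
    define B where "B = hnf a b d"
    have LB: "L = lat B" and B: "det B > 0" using abd by (simp_all add: B_def det_hnf)
    have D': "L' = lat D" "det D = int M * int N" using D by (simp_all add: is_lattice_matrix_iff)
    have "lat D \<subseteq> lat B"
      using subgroup_Z2_scale[OF sub] unfolding LB[symmetric] D'(1)[symmetric] by (auto simp: L_def)
    then obtain C where C: "D = C ** B" using lat_subset_imp_factor by blast
    have CB: "det C * det B = int M * int N" using D'(2) C by (simp add: det_mul)
    \<comment> \<open>Scalar matrices have determinant k^2, so the inclusions N Z^2 in
      \<open>lat B\<close> and M Z^2 in \<open>lat C\<close> bound the two determinants only up to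
      squares; coprimality repairs this below.\<close>
    have det_mat: "det (mat k :: int^2^2) = k * k" for k by (simp add: det_2 mat_def)
    have lat_mat: "lat (mat k) \<subseteq> X \<longleftrightarrow> (\<forall>v. k *s v \<in> X)" for k X
      by (auto simp: lat_def vector_mult_mat)
    have "lat (mat (int N)) \<subseteq> lat B" unfolding lat_mat using NL LB by simp
    then obtain Y where "mat (int N) = Y ** B" using lat_subset_imp_factor by blast
    then have "det Y * det B = int N * int N" using det_mat[of "int N"] by (simp add: det_mul)
    then have "det B dvd int N * int N" by (metis dvd_triv_right)
    moreover have "int M *s v \<in> lat C" for v
    proof -
      have "v v* B \<in> L" unfolding LB lat_def by blast
      then have "(int M *s v) v* B \<in> lat (C ** B)" using D'(1) C by (simp add: L_def scale_vector_mult)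
      then obtain u where "(int M *s v) v* B = (u v* C) v* B"
        unfolding lat_def by (auto simp flip: vector_matrix_mul_assoc)
      then have "int M *s v = u v* C" using vector_mult_cancel[of B "int M *s v" "u v* C"] B by simp
      then show ?thesis unfolding lat_def by blast
    qed
    then have "lat (mat (int M)) \<subseteq> lat C" unfolding lat_mat by simp
    then obtain X where "mat (int M) = X ** C" using lat_subset_imp_factor by blast
    then have "det X * det C = int M * int M" using det_mat[of "int M"] by (simp add: det_mul)
    then have "det C dvd int M * int M" by (metis dvd_triv_right)
    moreover have cop': "coprime (int M) (int N)" using cop by simp
    ultimately have "coprime (det B) (int M)" "coprime (det C) (int N)"
      by (meson coprime_mult_left_iff coprime_mult_right_iff coprime_divisors dvd_refl coprime_commute)+
    \<comment> \<open>\<open>det B\<close> divides M N and is prime to M; symmetrically for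
      \<open>det C\<close>.\<close>
    then have dvd: "det B dvd int N" "det C dvd int M"
      using CB by (metis coprime_dvd_mult_right_iff dvd_triv_right, metis coprime_dvd_mult_left_iff dvd_triv_left)
    have Cpos: "det C > 0" using CB B M N by (metis mult_pos_pos of_nat_0_less_iff less_le_trans zero_less_one zero_less_mult_pos2)
    have "det B \<le> int N" "det C \<le> int M" using dvd N M by (auto intro: zdvd_imp_le)
    \<comment> \<open>Both factors are bounded above and their product attains the product of the
      bounds.\<close>
    have "det B = int N"
    proof (rule ccontr)
      assume "det B \<noteq> int N"
      then have "int M * det B < int M * int N" using \<open>det B \<le> int N\<close> M by simp
      moreover have "det C * det B \<le> int M * det B"
        using \<open>det C \<le> int M\<close> B by (simp add: mult_right_mono)
      ultimately show False using CB by simp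
    qed
    then have "det C = int M" using CB N by simp
    have LN: "L \<in> sublattices N"
      using lat_mem_sublattices[OF B] \<open>det B = int N\<close> LB by simp
    have "is_lattice_matrix N L B" using LB \<open>det B = int N\<close> by (simp add: is_lattice_matrix_iff)
    from is_lattice_matrix_unique[OF A[OF LN] this N] obtain U where U: "det U = 1" "B = U ** A L" .
    \<comment> \<open>The basis \<open>B\<close> is exchanged for the prescribed matrix
      \<open>A L\<close>; the factor \<open>U\<close> is absorbed into the lattice of index
      M.\<close>
    have "L' = lattice_act (lat (C ** U)) (A L)"
      using D'(1) C U(2) by (simp add: lattice_act_lat matrix_mul_assoc)
    moreover have "lat (C ** U) \<in> sublattices M"
      using lat_mem_sublattices[of "C ** U"] Cpos U(1) \<open>det C = int M\<close> by (simp add: det_mul)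
    ultimately show "L' \<in> (\<lambda>(L, K). lattice_act K (A L)) ` (sublattices N \<times> sublattices M)"
      using LN by force
  }
qed

lemma conjugate_pow:
  assumes "B ** A = A ** g"
  shows "B [^]\<^bsub>SL2Z\<^esub> (k::nat) ** A = A ** g [^]\<^bsub>SL2Z\<^esub> k"
proof (induction k)
  case (Suc k)
  have "B [^]\<^bsub>SL2Z\<^esub> Suc k ** A = B [^]\<^bsub>SL2Z\<^esub> k ** (A ** g)"
    using assms by (simp flip: matrix_mul_assoc)
  also have "\<dots> = (B [^]\<^bsub>SL2Z\<^esub> k ** A) ** g" by (simp add: matrix_mul_assoc)
  also have "\<dots> = A ** g [^]\<^bsub>SL2Z\<^esub> Suc k" using Suc by (simp add: matrix_mul_assoc)
  finally show ?case .
qed simp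

text \<open>In the basis \<open>A\<close> of \<open>L\<close>, the power of \<open>a\<close> given
  by the period of \<open>L\<close> acts as \<beta>, so its j-th power fixes K A exactly if
  \<beta>^j fixes \<open>K\<close>. Conjugation by \<open>C ** A\<close> is conjugation by
  \<open>A\<close> followed by conjugation by \<open>C\<close>.\<close>

lemma composite_period_class:
  assumes A: "is_lattice_matrix N L A" and K: "K \<in> sublattices M"
    and N: "N \<ge> 1" and M: "M \<ge> 1" and cop: "coprime M N" and a: "det a = 1"
  defines "\<beta> \<equiv> hecke_conj A (a [^]\<^bsub>SL2Z\<^esub> period a L)"
  shows "period a (lattice_act K A) = period a L * period \<beta> K"
    and "hecke_class (M * N) a (lattice_act K A) = hecke_class M \<beta> K"
proof -
  have L: "L \<in> sublattices N" by (rule is_lattice_matrixD[OF A N])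
  have MN: "M * N \<ge> 1" using M N by simp
  have detA: "det A \<noteq> 0" using A N by (simp add: is_lattice_matrix_iff)
  note stab = period_mem_stab[OF L N a]
  have \<beta>: "det \<beta> = 1" "\<beta> ** A = A ** a [^]\<^bsub>SL2Z\<^esub> period a L"
    unfolding \<beta>_def using stab_conjugate[OF A N stab] by simp_all
  obtain C where C: "is_lattice_matrix M K C" using sublattice_matrix_exists[OF K M] by blast
  have CA: "is_lattice_matrix (M * N) (lattice_act K A) (C ** A)"
    using A C by (simp add: is_lattice_matrix_iff lattice_act_lat det_mul)
  have L': "lattice_act K A \<in> sublattices (M * N)" by (rule is_lattice_matrixD[OF CA MN])
  have pow: "A ** a [^]\<^bsub>SL2Z\<^esub> (period a L * j) = \<beta> [^]\<^bsub>SL2Z\<^esub> j ** A" for j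
    using conjugate_pow[OF \<beta>(2), of j] a by (simp add: SL2Z.nat_pow_pow)
  have act: "lattice_act (lattice_act K A) (a [^]\<^bsub>SL2Z\<^esub> (period a L * j)) = lattice_act K A
      \<longleftrightarrow> period \<beta> K dvd j" for j
  proof -
    have "lattice_act (lattice_act K A) (a [^]\<^bsub>SL2Z\<^esub> (period a L * j))
        = lattice_act (lattice_act K (\<beta> [^]\<^bsub>SL2Z\<^esub> j)) A"
      by (simp add: lattice_act_act pow)
    then show ?thesis using lattice_act_cancel[OF detA] period(2)[OF K M \<beta>(1)] by simp
  qed
  show p: "period a (lattice_act K A) = period a L * period \<beta> K"
  proof (rule period_eqI[OF L' MN a])
    fix k
    \<comment> \<open>Here coprimality enters: a power fixing K A fixes the lattice \<open>L\<close>
      recovered from it, so only multiples of the period of \<open>L\<close> can occur.\<close>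
    have "period a L dvd k" if "lattice_act (lattice_act K A) (a [^]\<^bsub>SL2Z\<^esub> k) = lattice_act K A"
    proof -
      have "a [^]\<^bsub>SL2Z\<^esub> k \<in> lattice_stab (lattice_act K A)"
        using that a by (simp add: mem_stab_iff det_SL2Z_pow)
      from stab_divided_lattice[OF this, of "int M"] have "lattice_act L (a [^]\<^bsub>SL2Z\<^esub> k) = L"
        unfolding intermediate_lattice[OF A K N M cop] .
      then show ?thesis using period(2)[OF L N a] by simp
    qed
    moreover have "period a L dvd k" if "period a L * period \<beta> K dvd k"
      using that by (rule dvd_mult_left)
    moreover have "lattice_act (lattice_act K A) (a [^]\<^bsub>SL2Z\<^esub> k) = lattice_act K A
        \<longleftrightarrow> period a L * period \<beta> K dvd k" if k: "period a L dvd k"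
    proof -
      obtain j where "k = period a L * j" using k by (rule dvdE)
      then show ?thesis using act[of j] period(1)[OF L N a] by simp
    qed
    ultimately show "lattice_act (lattice_act K A) (a [^]\<^bsub>SL2Z\<^esub> k) = lattice_act K A
        \<longleftrightarrow> period a L * period \<beta> K dvd k"
      by blast
  qed
  define \<delta> where "\<delta> = hecke_conj C (\<beta> [^]\<^bsub>SL2Z\<^esub> period \<beta> K)"
  have \<delta>: "\<delta> ** C = C ** \<beta> [^]\<^bsub>SL2Z\<^esub> period \<beta> K"
    unfolding \<delta>_def by (rule stab_conjugate(2)[OF C M period_mem_stab[OF K M \<beta>(1)]])
  have "\<delta> ** (C ** A) = (\<delta> ** C) ** A" by (simp add: matrix_mul_assoc)
  also have "\<dots> = (C ** A) ** a [^]\<^bsub>SL2Z\<^esub> period a (lattice_act K A)"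
    unfolding \<delta> p by (simp add: pow flip: matrix_mul_assoc)
  finally have "hecke_conj (C ** A) (a [^]\<^bsub>SL2Z\<^esub> period a (lattice_act K A)) = \<delta>"
    using CA MN by (intro hecke_conj_eq) (auto simp: is_lattice_matrix_iff)
  then show "hecke_class (M * N) a (lattice_act K A) = hecke_class M \<beta> K"
    using hecke_class_eq[OF CA MN a] hecke_class_eq[OF C M \<beta>(1)] by (simp add: \<delta>_def)
qed

text \<open>Moves the outer operator into the test function, so that the formula for a single class
  can be applied to the inner operator.\<close>

lemma frag_eval_hecke_extend:
  "frag_eval f (hecke N z) = frag_eval (\<lambda>C. frag_eval f (hecke N (frag_of C))) z"
  using subset_UNIV
  by (induction z rule: frag_induction) (auto simp: frag_eval_diff hecke_diff)

text \<open>Stronger than commutation, which follows because the right side is symmetric in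
  \<open>M\<close> and \<open>N\<close>. The weights of a chain multiply to the weight of its
  smallest lattice by \<open>composite_period_class\<close>.\<close>

lemma hecke_mult:
  assumes N: "N \<ge> 1" and M: "M \<ge> 1" and cop: "coprime M N" and z: "z \<in> carrier (Zlambda SL2Z)"
  shows "hecke M (hecke N z) = hecke (M * N) z"
  using z
proof (induction z rule: Zlambda_induct)
  case (frag_of a)
  then have a: "det a = 1" by simp
  have MN: "M * N \<ge> 1" using M N by simp
  define A where "A L = (SOME A. is_lattice_matrix N L A)" for L
  have A: "is_lattice_matrix N L (A L)" if "L \<in> sublattices N" for L
    unfolding A_def by (rule someI_ex) (rule sublattice_matrix_exists[OF that N])
  define \<beta> where "\<beta> L = hecke_conj (A L) (a [^]\<^bsub>SL2Z\<^esub> period a L)" for L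
  show ?case
  proof (rule frag_eqI)
    fix f
    have "frag_eval f (hecke M (hecke N (frag_of (conj_class SL2Z a))))
        = (\<Sum>L\<in>sublattices N. frag_eval f (hecke M (frag_of (hecke_class N a L))) / period a L)"
      by (subst frag_eval_hecke_extend) (rule frag_eval_hecke[OF N a])
    also have "\<dots> = (\<Sum>L\<in>sublattices N. \<Sum>K\<in>sublattices M.
        f (hecke_class (M * N) a (lattice_act K (A L))) / period a (lattice_act K (A L)))"
    proof (rule sum.cong[OF refl])
      fix L assume L: "L \<in> sublattices N"
      have "det (\<beta> L) = 1"
        unfolding \<beta>_def by (rule stab_conjugate(1)[OF A[OF L] N period_mem_stab[OF L N a]])
      then have "frag_eval f (hecke M (frag_of (hecke_class N a L)))
          = (\<Sum>K\<in>sublattices M. f (hecke_class M (\<beta> L) K) / period (\<beta> L) K)"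
        using frag_eval_hecke[OF M, of "\<beta> L" f] hecke_class_eq[OF A[OF L] N a] by (simp add: \<beta>_def)
      then show "frag_eval f (hecke M (frag_of (hecke_class N a L))) / period a L
          = (\<Sum>K\<in>sublattices M. f (hecke_class (M * N) a (lattice_act K (A L))) / period a (lattice_act K (A L)))"
        using composite_period_class[OF A[OF L] _ N M cop a]
        by (simp add: sum_divide_distrib \<beta>_def mult.commute)
    qed
    also have "\<dots> = (\<Sum>(L, K)\<in>sublattices N \<times> sublattices M.
        f (hecke_class (M * N) a (lattice_act K (A L))) / period a (lattice_act K (A L)))"
      by (rule sum.cartesian_product)
    also have "\<dots> = (\<Sum>L'\<in>sublattices (M * N). f (hecke_class (M * N) a L') / period a L')"
      using sum.reindex_bij_betw[OF bij_betw_sublattice_pairs[OF N M cop A], of "\<lambda>L'. f (hecke_class (M * N) a L') / period a L'"]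
      by (simp add: case_prod_unfold)
    also have "\<dots> = frag_eval f (hecke (M * N) (frag_of (conj_class SL2Z a)))"
      by (rule frag_eval_hecke[OF MN a, symmetric])
    finally show "frag_eval f (hecke M (hecke N (frag_of (conj_class SL2Z a))))
        = frag_eval f (hecke (M * N) (frag_of (conj_class SL2Z a)))" .
  qed
qed (simp_all add: hecke_diff)

section \<open>Descent to the projective group\<close>

lemma neg_mult:
  "(- A) ** B = - (A ** B)" "A ** (- B) = - (A ** B)" "det (- A) = det A" for A B :: "int^2^2"
  by (simp_all add: matrix_matrix_mult_def vec_eq_iff forall_2 sum_2 det_2)

lemma group_PSL2Z: "group PSL2Z"
  unfolding PSL2Z_def using normal.factorgroup_is_group[OF normal_center_SL2Z] .

lemma proj_hom: "proj_PSL2Z \<in> hom SL2Z PSL2Z"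
  unfolding PSL2Z_def proj_PSL2Z_def using normal.r_coset_hom_Mod[OF normal_center_SL2Z] .

interpretation proj: group_hom SL2Z PSL2Z proj_PSL2Z
  by (simp add: group_hom_def group_hom_axioms_def group_SL2Z group_PSL2Z proj_hom)

lemma proj_eq: "proj_PSL2Z a = {a, - a}"
  unfolding proj_PSL2Z_def r_coset_def by (auto simp: neg_mult)

lemma proj_neg: "proj_PSL2Z (- a) = proj_PSL2Z a"
  by (auto simp: proj_eq)

lemma carrier_PSL2Z: "carrier PSL2Z = proj_PSL2Z ` carrier SL2Z"
  unfolding PSL2Z_def proj_PSL2Z_def FactGroup_def RCOSETS_def by auto

definition to_PSL2Z :: "((int^2^2) set \<Rightarrow>\<^sub>0 int) \<Rightarrow> ((int^2^2) set set \<Rightarrow>\<^sub>0 int)" where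
  "to_PSL2Z = induced_map SL2Z PSL2Z proj_PSL2Z"

lemma to_PSL2Z_frag_of:
  "det a = 1 \<Longrightarrow> to_PSL2Z (frag_of (conj_class SL2Z a)) = frag_of (conj_class PSL2Z (proj_PSL2Z a))"
  unfolding to_PSL2Z_def using induced_map_frag_of[OF group_SL2Z group_PSL2Z proj_hom] by simp

lemma to_PSL2Z_diff: "to_PSL2Z (x - y) = to_PSL2Z x - to_PSL2Z y"
  by (simp add: to_PSL2Z_def induced_map_def frag_extend_diff)

lemma to_PSL2Z_0 [simp]: "to_PSL2Z 0 = 0"
  using to_PSL2Z_diff[of 0 0] by simp

lemma to_PSL2Z_hom: "to_PSL2Z \<in> hom (Zlambda SL2Z) (Zlambda PSL2Z)"
  unfolding to_PSL2Z_def by (rule induced_map_in_hom[OF group_SL2Z group_PSL2Z proj_hom])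

lemma Zlambda_diff_closed:
  "x \<in> carrier (Zlambda G) \<Longrightarrow> y \<in> carrier (Zlambda G) \<Longrightarrow> x - y \<in> carrier (Zlambda G)"
  unfolding Zlambda_def using keys_diff[of x y] by auto

lemma to_PSL2Z_epi: "to_PSL2Z \<in> epi (Zlambda SL2Z) (Zlambda PSL2Z)"
proof -
  have "\<exists>z\<in>carrier (Zlambda SL2Z). to_PSL2Z z = y" if "y \<in> carrier (Zlambda PSL2Z)" for y
    using that
  proof (induction y rule: Zlambda_induct)
    case zero
    have "0 \<in> carrier (Zlambda SL2Z)" by (simp add: Zlambda_def)
    then show ?case using to_PSL2Z_0 by blast
  next
    case (frag_of x)
    then obtain a where a: "det a = 1" "x = proj_PSL2Z a" by (auto simp: carrier_PSL2Z)
    have "frag_of (conj_class SL2Z a) \<in> carrier (Zlambda SL2Z)"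
      using a(1) by (simp add: Zlambda_def conj_classes_def)
    then show ?case using to_PSL2Z_frag_of[OF a(1)] a(2) by blast
  next
    case (diff x y)
    then show ?case using to_PSL2Z_diff Zlambda_diff_closed by metis
  qed
  then have "to_PSL2Z ` carrier (Zlambda SL2Z) = carrier (Zlambda PSL2Z)"
    using hom_carrier[OF to_PSL2Z_hom] by blast
  then show ?thesis using to_PSL2Z_hom by (simp add: epi_def)
qed

lemma neg_pow: "(- a) [^]\<^bsub>SL2Z\<^esub> (k::nat) \<in> {a [^]\<^bsub>SL2Z\<^esub> k, - (a [^]\<^bsub>SL2Z\<^esub> k)}"
  by (induction k) (auto simp: neg_mult)

lemma lattice_act_neg:
  assumes "subgroup L Z2"
  shows "lattice_act L (- g) = lattice_act L g"
proof -
  have minus: "- v \<in> L" if "v \<in> L" for v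
    using assms that unfolding subgroup_Z2_iff by (metis diff_0)
  have eq: "v v* (- g) = (- v) v* g" for v
    by (simp add: vector_matrix_mult_def vec_eq_iff)
  have "uminus ` L = L"
    using minus by (auto intro: image_eqI[of _ uminus "- x" for x])
  moreover have "lattice_act L (- g) = (\<lambda>v. v v* g) ` uminus ` L"
    unfolding lattice_act_def by (simp add: eq image_image)
  ultimately show ?thesis by (simp add: lattice_act_def)
qed

text \<open>The test function \<open>f'\<close> is pulled back from PSL2(Z), so it has the same
  value at a class and at its negative; the two sums over sublattices then agree term by
  term.\<close>

lemma to_PSL2Z_hecke_neg:
  assumes N: "N \<ge> 1" and a: "det a = 1"
  shows "to_PSL2Z (hecke N (frag_of (conj_class SL2Z (- a)))) = to_PSL2Z (hecke N (frag_of (conj_class SL2Z a)))"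
proof (rule frag_eqI)
  fix f
  define f' where "f' C = frag_eval f (to_PSL2Z (frag_of C))" for C
  have f': "f' (conj_class SL2Z b) = f (conj_class PSL2Z (proj_PSL2Z b))" if "det b = 1" for b
    using that by (simp add: f'_def to_PSL2Z_frag_of)
  have ext: "frag_eval f (to_PSL2Z z) = frag_eval f' z" for z
    unfolding f'_def using subset_UNIV
    by (induction z rule: frag_induction) (auto simp: frag_eval_diff to_PSL2Z_diff)
  have na: "det (- a) = 1" using a by (simp add: neg_mult)
  have "(\<Sum>L\<in>sublattices N. f' (hecke_class N (- a) L) / period (- a) L)
      = (\<Sum>L\<in>sublattices N. f' (hecke_class N a L) / period a L)"
  proof (rule sum.cong[OF refl])
    fix L assume L: "L \<in> sublattices N"
    then have sub: "subgroup L Z2" by (simp add: sublattices_def)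
    obtain A where A: "is_lattice_matrix N L A" using sublattice_matrix_exists[OF L N] by blast
    have "lattice_act L ((- a) [^]\<^bsub>SL2Z\<^esub> k) = lattice_act L (a [^]\<^bsub>SL2Z\<^esub> k)" for k :: nat
      using neg_pow[of a k] lattice_act_neg[OF sub] by auto
    then have p: "period (- a) L = period a L"
      by (intro period_eqI[OF L N na]) (simp add: period(2)[OF L N a])
    define g where "g = a [^]\<^bsub>SL2Z\<^esub> period a L"
    define g' where "g' = (- a) [^]\<^bsub>SL2Z\<^esub> period a L"
    have g: "g \<in> lattice_stab L" unfolding g_def by (rule period_mem_stab[OF L N a])
    have detA: "det A \<noteq> 0" using A N by (simp add: is_lattice_matrix_iff)
    note sc = stab_conjugate[OF A N g]
    have "hecke_conj A (- g) = - hecke_conj A g"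
      by (rule hecke_conj_eq[OF detA]) (simp add: neg_mult sc(2))
    \<comment> \<open>The sign is governed by the parity of the period; both cases are
      harmless.\<close>
    moreover have "g' = g \<or> g' = - g" using neg_pow[of a "period a L"] by (auto simp: g_def g'_def)
    ultimately have "hecke_conj A g' = hecke_conj A g \<or> hecke_conj A g' = - hecke_conj A g" by auto
    then have "f' (conj_class SL2Z (hecke_conj A g')) = f' (conj_class SL2Z (hecke_conj A g))"
      using sc(1) by (auto simp: f' neg_mult proj_neg)
    then show "f' (hecke_class N (- a) L) / period (- a) L = f' (hecke_class N a L) / period a L"
      using hecke_class_eq[OF A N a] hecke_class_eq[OF A N na] p by (simp add: g_def g'_def)
  qed
  then show "frag_eval f (to_PSL2Z (hecke N (frag_of (conj_class SL2Z (- a)))))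
      = frag_eval f (to_PSL2Z (hecke N (frag_of (conj_class SL2Z a))))"
    unfolding ext frag_eval_hecke[OF N a] frag_eval_hecke[OF N na] .
qed

text \<open>The kernel of the projection is {1, -1}, so conjugacy of the images lifts to conjugacy
  of \<open>b\<close> with \<open>a\<close> or with \<open>- a\<close>.\<close>

lemma to_PSL2Z_hecke_cong:
  assumes N: "N \<ge> 1" and a: "det a = 1" and b: "det b = 1"
    and eq: "conj_class PSL2Z (proj_PSL2Z b) = conj_class PSL2Z (proj_PSL2Z a)"
  shows "to_PSL2Z (hecke N (frag_of (conj_class SL2Z b))) = to_PSL2Z (hecke N (frag_of (conj_class SL2Z a)))"
proof -
  have "proj_PSL2Z b \<in> conj_class PSL2Z (proj_PSL2Z a)"
    using proj.H.conj_class_self[of "proj_PSL2Z b"] b eq by (simp add: carrier_PSL2Z)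
  then obtain g where g: "det g = 1"
    "proj_PSL2Z b = proj_PSL2Z g \<otimes>\<^bsub>PSL2Z\<^esub> proj_PSL2Z a \<otimes>\<^bsub>PSL2Z\<^esub> inv\<^bsub>PSL2Z\<^esub> (proj_PSL2Z g)"
    by (auto simp: conj_class_def carrier_PSL2Z)
  then have "proj_PSL2Z b = proj_PSL2Z (g ** a ** inv\<^bsub>SL2Z\<^esub> g)"
    using a proj.hom_mult[of g a] proj.hom_mult[of "g ** a" "inv\<^bsub>SL2Z\<^esub> g"] proj.hom_inv[of g]
    by (simp add: det_mul SL2Z_inv)
  then have "b = g ** a ** inv\<^bsub>SL2Z\<^esub> g \<or> b = g ** (- a) ** inv\<^bsub>SL2Z\<^esub> g"
    by (auto simp: proj_eq neg_mult doubleton_eq_iff)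
  then have "conj_class SL2Z b = conj_class SL2Z a \<or> conj_class SL2Z b = conj_class SL2Z (- a)"
    using SL2Z.conj_class_conj[of a g] SL2Z.conj_class_conj[of "- a" g] a g(1) by (auto simp: neg_mult)
  then show ?thesis using to_PSL2Z_hecke_neg[OF N a] by auto
qed

text \<open>\<open>T\<close> is prescribed on each class through an arbitrary lift and extended
  additively; \<open>to_PSL2Z_hecke_cong\<close> shows that the lift does not matter, which is what
  makes the square commute.\<close>

lemma hecke_descends:
  assumes N: "N \<ge> 1"
  shows "\<exists>T \<in> hom (Zlambda PSL2Z) (Zlambda PSL2Z).
    \<forall>z\<in>carrier (Zlambda SL2Z). T (to_PSL2Z z) = to_PSL2Z (hecke N z)"
proof -
  define rep where "rep D = (SOME a. det a = 1 \<and> conj_class PSL2Z (proj_PSL2Z a) = D)" for D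
  define T where "T = frag_extend (\<lambda>D. to_PSL2Z (hecke N (frag_of (conj_class SL2Z (rep D)))))"
  have rep: "det (rep (conj_class PSL2Z (proj_PSL2Z a))) = 1 \<and>
      conj_class PSL2Z (proj_PSL2Z (rep (conj_class PSL2Z (proj_PSL2Z a)))) = conj_class PSL2Z (proj_PSL2Z a)"
    if "det a = 1" for a
    unfolding rep_def by (rule someI[of _ a]) (use that in simp)
  have "T \<in> hom (Zlambda PSL2Z) (Zlambda PSL2Z)"
    unfolding T_def
  proof (rule frag_extend_in_hom_Zlambda)
    fix D assume "D \<in> conj_classes PSL2Z"
    then obtain a where "det a = 1" "D = conj_class PSL2Z (proj_PSL2Z a)"
      by (auto simp: conj_classes_def carrier_PSL2Z)
    then have "frag_of (conj_class SL2Z (rep D)) \<in> carrier (Zlambda SL2Z)"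
      using rep by (simp add: Zlambda_def conj_classes_def)
    then show "to_PSL2Z (hecke N (frag_of (conj_class SL2Z (rep D)))) \<in> carrier (Zlambda PSL2Z)"
      using hom_in_carrier[OF to_PSL2Z_hom] hom_in_carrier[OF hecke_in_hom[OF N]] by blast
  qed
  moreover have "T (to_PSL2Z z) = to_PSL2Z (hecke N z)" if "z \<in> carrier (Zlambda SL2Z)" for z
    using that
  proof (induction z rule: Zlambda_induct)
    case (frag_of a)
    then have a: "det a = 1" by simp
    show ?case
      using to_PSL2Z_hecke_cong[OF N a] rep[OF a] by (simp add: T_def to_PSL2Z_frag_of[OF a])
  qed (simp_all add: T_def to_PSL2Z_diff hecke_diff frag_extend_diff)
  ultimately show ?thesis by blast
qed

text \<open>In a logic of total functions an ill-posed definition still denotes something. The first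
  part therefore certifies each ingredient: finite ranges of summation, integrality of the
  conjugates, existence of matrices and representatives, and independence of all choices.\<close>

theorem theorem1:
  shows
    \<comment> \<open>the operators are well defined endomorphisms, independent of all choices\<close>
    "(\<forall>N\<ge>1.
        (\<forall>L\<in>sublattices N.
           subgroup (lattice_stab L) SL2Z \<and> finite (rcosets\<^bsub>SL2Z\<^esub> (lattice_stab L)) \<and>
           (\<exists>A. is_lattice_matrix N L A) \<and>
           (\<forall>A. is_lattice_matrix N L A \<longrightarrow>
              hecke_conj A \<in> hom (stab_group L) SL2Z \<and>
              (\<forall>\<gamma>\<in>lattice_stab L. rat_matrix (hecke_conj A \<gamma>) = rat_conj A \<gamma>)) \<and>
           (\<forall>\<alpha>\<in>carrier SL2Z.
              finite (double_cosets SL2Z (lattice_stab L) \<alpha>) \<and>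
              (\<forall>g. (\<forall>s\<in>double_cosets SL2Z (lattice_stab L) \<alpha>. g s \<in> s) \<longrightarrow>
                 pullback SL2Z (lattice_stab L) (frag_of (conj_class SL2Z \<alpha>))
                   = pullback_sum SL2Z (lattice_stab L) \<alpha> g)) \<and>
           pullback SL2Z (lattice_stab L) \<in> hom (Zlambda SL2Z) (Zlambda (stab_group L))) \<and>
        (\<exists>R A. hecke_choice N R A) \<and>
        (\<forall>R A. hecke_choice N R A \<longrightarrow>
           finite R \<and> (\<forall>z\<in>carrier (Zlambda SL2Z). hecke N z = hecke_sum R A z)) \<and>
        hecke N \<in> hom (Zlambda SL2Z) (Zlambda SL2Z))
    \<and>
    (\<forall>M\<ge>1. \<forall>N\<ge>1. coprime M N \<longrightarrow>
        (\<forall>z\<in>carrier (Zlambda SL2Z). hecke N (hecke M z) = hecke M (hecke N z)))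
    \<and>
    \<comment> \<open>descent along the natural surjection\<close>
    induced_map SL2Z PSL2Z proj_PSL2Z \<in> epi (Zlambda SL2Z) (Zlambda PSL2Z) \<and>
    (\<forall>N\<ge>1. \<exists>T \<in> hom (Zlambda PSL2Z) (Zlambda PSL2Z).
        \<forall>z\<in>carrier (Zlambda SL2Z).
          T (induced_map SL2Z PSL2Z proj_PSL2Z z) = induced_map SL2Z PSL2Z proj_PSL2Z (hecke N z))"
proof (intro conjI allI ballI impI)
  fix N :: nat assume N: "N \<ge> 1"
  show "\<exists>R A. hecke_choice N R A" by (rule hecke_choice_exists[OF N])
  show "hecke N \<in> hom (Zlambda SL2Z) (Zlambda SL2Z)" by (rule hecke_in_hom[OF N])
  show "\<exists>T \<in> hom (Zlambda PSL2Z) (Zlambda PSL2Z). \<forall>z\<in>carrier (Zlambda SL2Z).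
      T (induced_map SL2Z PSL2Z proj_PSL2Z z) = induced_map SL2Z PSL2Z proj_PSL2Z (hecke N z)"
    using hecke_descends[OF N] unfolding to_PSL2Z_def .
  {
    fix L assume L: "L \<in> sublattices N"
    show "subgroup (lattice_stab L) SL2Z" by (rule subgroup_stab)
    show fin: "finite (rcosets\<^bsub>SL2Z\<^esub> (lattice_stab L))" by (rule finite_rcosets_stab[OF L N])
    show "\<exists>A. is_lattice_matrix N L A" by (rule sublattice_matrix_exists[OF L N])
    show "pullback SL2Z (lattice_stab L) \<in> hom (Zlambda SL2Z) (Zlambda (stab_group L))"
      by (rule SL2Z.pullback_in_hom[OF subgroup_stab fin])
    fix \<alpha> assume \<alpha>: "\<alpha> \<in> carrier SL2Z"
    show "finite (double_cosets SL2Z (lattice_stab L) \<alpha>)" by (rule SL2Z.finite_double_cosets[OF fin])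
    fix g assume "\<forall>s\<in>double_cosets SL2Z (lattice_stab L) \<alpha>. g s \<in> s"
    then show "pullback SL2Z (lattice_stab L) (frag_of (conj_class SL2Z \<alpha>))
        = pullback_sum SL2Z (lattice_stab L) \<alpha> g"
      by (intro SL2Z.pullback_frag_of[OF subgroup_stab fin \<alpha>]) blast
  next
    fix L A assume A: "is_lattice_matrix N L A"
    show "hecke_conj A \<in> hom (stab_group L) SL2Z" by (rule hecke_conj_hom[OF A N])
    fix \<gamma> assume "\<gamma> \<in> lattice_stab L"
    then show "rat_matrix (hecke_conj A \<gamma>) = rat_conj A \<gamma>" by (rule stab_conjugate(3)[OF A N])
  next
    fix R A assume RA: "hecke_choice N R A"
    then have "R \<subseteq> sublattices N" by (simp add: hecke_choice_def)
    then show "finite R" using finite_sublattices[OF N] by (rule finite_subset)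
    fix z assume "z \<in> carrier (Zlambda SL2Z)"
    then show "hecke N z = hecke_sum R A z" by (rule hecke_sum_eq_hecke[OF RA N])
  }
next
  fix M N :: nat and z
  assume "M \<ge> 1" "N \<ge> 1" "coprime M N" "z \<in> carrier (Zlambda SL2Z)"
  \<comment> \<open>Both sides equal \<open>hecke (M * N) z\<close>.\<close>
  then show "hecke N (hecke M z) = hecke M (hecke N z)"
    using hecke_mult[of N M z] hecke_mult[of M N z] by (simp add: coprime_commute mult.commute)
next
  show "induced_map SL2Z PSL2Z proj_PSL2Z \<in> epi (Zlambda SL2Z) (Zlambda PSL2Z)"
    using to_PSL2Z_epi by (simp add: to_PSL2Z_def)
qed

end
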